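(* Fix $s\in\mathbb C$ and let $\mathcal E_s$ be the complex vector space of functions of $(a,c)\in(0,1)\times(0,1)$ spanned by the four functions $L^{+}(s,a,c)$, $L^{-}(s,a,c)$, $e^{-2\pi i ac}L^{+}(1-s,1-c,a)$, $e^{-2\pi i ac}L^{-}(1-s,1-c,a)$. Let $\Box=[0,1]^2$. (1) Suppose $1\le p<2$. Then all functions in $\mathcal E_s$ belong to $L^p(\Box,da\,dc)$ if and only if $1-\frac1p<\Re(s)<\frac1p$. Otherwise, no nonzero function in $\mathcal E_s$ belongs to $L^p(\Box,da\,dc)$. (2) Suppose $2\le p\le\infty$. Then for every $s\in\mathbb C$, no nonzero function in $\mathcal E_s$ belongs to $L^p(\Box,da\,dc)$.
   Context: For $0<a,c<1$ and $\Re(s)>1$ let $L^{+}(s,a,c)=\sum_{n\in\mathbb Z}e^{2\pi i n a}|n+c|^{-s}$ and $L^{-}(s,a,c)=\sum_{n\in\mathbb Z}\mathrm{sgn}(n+c)e^{2\pi i n a}|n+c|^{-s}$; equivalently $L^{\pm}(s,a,c)=\zeta(s,a,c)\pm e^{-2\pi i a}\zeta(s,1-a,1-c)$ with $\zeta(s,a,c)=\sum_{n\ge0}e^{2\pi i na}(n+c)^{-s}$. For fixed $0<a,c<1$ these extend by analytic continuation to entire functions of $s\in\mathbb C$, and $L^\pm(s,a,c)$ for arbitrary $s$ means this continuation. *)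

theory Defs
  imports
    "HOL-Complex_Analysis.Complex_Analysis"
    "HOL-Library.Function_Algebras"
begin

definition Lerch_plus_series :: "complex \<Rightarrow> real \<Rightarrow> real \<Rightarrow> complex" where
  "Lerch_plus_series s a c =
     (\<Sum>\<^sub>\<infinity>n\<in>(UNIV :: int set).
        exp (2 * pi * \<i> * of_int n * a) * complex_of_real \<bar>of_int n + c\<bar> powr (- s))"

definition Lerch_minus_series :: "complex \<Rightarrow> real \<Rightarrow> real \<Rightarrow> complex" where
  "Lerch_minus_series s a c =
     (\<Sum>\<^sub>\<infinity>n\<in>(UNIV :: int set).
        complex_of_real (sgn (of_int n + c)) * exp (2 * pi * \<i> * of_int n * a) *
        complex_of_real \<bar>of_int n + c\<bar> powr (- s))"

text \<open>The entire function that agrees with \<open>F\<close> on the half-plane \<open>Re z > 1\<close>. There is at most one,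
  by the identity theorem.\<close>

definition entire_continuation :: "(complex \<Rightarrow> complex) \<Rightarrow> complex \<Rightarrow> complex" where
  "entire_continuation F =
     (THE G. G holomorphic_on UNIV \<and> (\<forall>z. Re z > 1 \<longrightarrow> G z = F z))"

lemma entire_continuation_unique:
  assumes "G holomorphic_on UNIV" "\<And>z. Re z > 1 \<Longrightarrow> G z = F z"
    and "H holomorphic_on UNIV" "\<And>z. Re z > 1 \<Longrightarrow> H z = F z"
  shows "G = H"
proof
  fix w
  have "open {z. Re z > 1}" by (rule open_halfspace_Re_gt)
  moreover have "{z. Re z > 1} \<noteq> {}"
    using Re_complex_of_real[of 2] by (metis (mono_tags, lifting) empty_iff mem_Collect_eq one_less_numeral_iff semiring_norm(76))
  ultimately show "G w = H w"
    using assms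
    by (intro analytic_continuation_open[of "{z. Re z > 1}" UNIV G H w]) auto
qed

lemma entire_continuation_eqI:
  assumes "G holomorphic_on UNIV" "\<And>z. Re z > 1 \<Longrightarrow> G z = F z"
  shows "entire_continuation F = G"
  unfolding entire_continuation_def
proof (rule the_equality)
  show "G holomorphic_on UNIV \<and> (\<forall>z. Re z > 1 \<longrightarrow> G z = F z)"
    using assms by blast
next
  fix H assume "H holomorphic_on UNIV \<and> (\<forall>z. Re z > 1 \<longrightarrow> H z = F z)"
  then show "H = G"
    using assms by (intro entire_continuation_unique[of H F G]) simp_all
qed

definition Lerch_plus :: "complex \<Rightarrow> real \<Rightarrow> real \<Rightarrow> complex" where
  "Lerch_plus s a c = entire_continuation (\<lambda>z. Lerch_plus_series z a c) s"

definition Lerch_minus :: "complex \<Rightarrow> real \<Rightarrow> real \<Rightarrow> complex" where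
  "Lerch_minus s a c = entire_continuation (\<lambda>z. Lerch_minus_series z a c) s"

text \<open>A function on the open unit square is represented by its extension by zero to the plane, so
  that two such functions are equal iff they agree on the open square.\<close>

definition on_open_square :: "(real \<Rightarrow> real \<Rightarrow> complex) \<Rightarrow> real \<times> real \<Rightarrow> complex" where
  "on_open_square g = (\<lambda>(a, c). if 0 < a \<and> a < 1 \<and> 0 < c \<and> c < 1 then g a c else 0)"

definition fun_scale :: "complex \<Rightarrow> ('a \<Rightarrow> complex) \<Rightarrow> 'a \<Rightarrow> complex" where
  "fun_scale k f = (\<lambda>x. k * f x)"

lemma vector_space_fun_scale: "vector_space fun_scale"
  by unfold_locales (auto simp: fun_scale_def fun_eq_iff algebra_simps)

definition Lerch_space :: "complex \<Rightarrow> (real \<times> real \<Rightarrow> complex) set" where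
  "Lerch_space s = module.span fun_scale
     {on_open_square (\<lambda>a c. Lerch_plus s a c),
      on_open_square (\<lambda>a c. Lerch_minus s a c),
      on_open_square (\<lambda>a c. exp (- (2 * pi * \<i> * a * c)) * Lerch_plus (1 - s) (1 - c) a),
      on_open_square (\<lambda>a c. exp (- (2 * pi * \<i> * a * c)) * Lerch_minus (1 - s) (1 - c) a)}"

text \<open>Membership in \<open>L\<^sup>p\<close> for an extended real exponent \<open>p \<ge> 1\<close>; for \<open>p = \<infinity>\<close> it is essential
  boundedness.\<close>

definition in_Lp :: "'a measure \<Rightarrow> ereal \<Rightarrow> ('a \<Rightarrow> complex) \<Rightarrow> bool" where
  "in_Lp M p f \<longleftrightarrow> f \<in> borel_measurable M \<and>
     (if p = \<infinity> then (\<exists>C. AE x in M. norm (f x) \<le> C)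
      else integrable M (\<lambda>x. norm (f x) powr real_of_ereal p))"

definition unit_square :: "(real \<times> real) measure" where
  "unit_square = lebesgue_on ({0..1} \<times> {0..1})"

end

theory Submission
  imports Defs "HOL-Probability.Probability" "HOL-Real_Asymp.Real_Asymp"
begin

text \<open>
  For \<open>k \<in> {0, 1}\<close> let \<open>\<theta>\<^sub>k(t, a, c) = \<Sum>\<^sub>n (n + c)^k exp (- \<pi>t(n + c)\<^sup>2) exp (2\<pi>ina)\<close>. Poisson summation gives
  \<open>\<theta>\<^sub>k(1/t, a, c) = i^k t^(k + 1/2) exp (- 2\<pi>iac) \<theta>\<^sub>k(t, 1 - c, a)\<close>, and Riemann's splitting of the Mellin
  integral at \<open>t = 1\<close> shows that \<open>L\<^sup>+\<close> (\<open>k = 0\<close>) and \<open>L\<^sup>-\<close> (\<open>k = 1\<close>), multiplied by \<open>\<pi>^(-(s+k)/2) \<Gamma>((s+k)/2)\<close>,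
  are entire functions \<open>\<Lambda>\<^sub>k\<close> satisfying \<open>\<Lambda>\<^sub>k(s, a, c) = i^k exp (- 2\<pi>iac) \<Lambda>\<^sub>k(1 - s, 1 - c, a)\<close>. Hence the Lerch
  space consists of combinations of \<open>\<Lambda>\<^sub>0\<close> and \<open>\<Lambda>\<^sub>1\<close>. In the half of the integral with parameters \<open>(a, c)\<close> only
  the terms \<open>n = 0\<close> and \<open>n = -1\<close> are not uniformly bounded; for \<open>Re s > 0\<close> they contribute multiples of
  \<open>c^(-s)\<close> and \<open>(1 - c)^(-s)\<close>, and for \<open>Re s < 1\<close> the other half contributes \<open>a^(s-1)\<close> and \<open>(1 - a)^(s-1)\<close>.
  The \<open>p\<close>-th powers of these are integrable exactly in the stated strip. For \<open>Re s \<ge> 1/p\<close> no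
  slice in \<open>c\<close>, and for \<open>Re s \<le> 1 - 1/p\<close> no slice in \<open>a\<close>, is \<open>p\<close>-integrable, because the coefficients
  of a nonzero combination at the two ends of the slice cannot both vanish.
\<close>

section \<open>Characters and Fourier uniqueness\<close>

definition character :: "real \<Rightarrow> complex" where
  "character x = cis (2 * pi * x)"

lemma character_eq_exp: "character x = exp (2 * pi * \<i> * x)"
  by (simp add: character_def cis_conv_exp mult_ac)

lemma character_0 [simp]: "character 0 = 1"
  by (simp add: character_def)

lemma character_nonzero [simp]: "character x \<noteq> 0"
  by (simp add: character_def)

lemma character_add: "character (x + y) = character x * character y"
  by (simp add: character_def cis_mult ring_distribs)

lemma character_diff: "character (x - y) = character x / character y"
  by (simp add: character_def cis_divide right_diff_distrib)

lemma cnj_character: "cnj (character x) = character (- x)"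
  by (simp add: character_def cis_cnj)

lemma norm_character [simp]: "norm (character x) = 1"
  by (simp add: character_def)

lemma character_of_int [simp]: "character (of_int n) = 1"
  by (simp add: character_def)

lemma continuous_on_character [continuous_intros]:
  "continuous_on A f \<Longrightarrow> continuous_on A (\<lambda>x. character (f x))"
  unfolding character_def by (intro continuous_intros)

lemma borel_measurable_character [measurable]: "character \<in> borel_measurable borel"
  by (intro borel_measurable_continuous_onI continuous_intros)

lemma has_vector_derivative_character:
  "((\<lambda>x. character (x * y)) has_vector_derivative 2 * pi * \<i> * y * character (x * y)) (at x within A)"
proof -
  have "((\<lambda>x. exp (2 * pi * \<i> * y * of_real x)) has_vector_derivative
      2 * pi * \<i> * y * exp (2 * pi * \<i> * y * of_real x)) (at x within A)"
    by (rule has_vector_derivative_real_field) (auto intro!: derivative_eq_intros)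
  then show ?thesis by (simp add: character_eq_exp mult_ac)
qed

lemma has_integral_character_of_int:
  "((\<lambda>x. character (of_int n * x)) has_integral (if n = 0 then 1 else 0)) {0..1}"
proof (cases "n = 0")
  case True
  then show ?thesis using has_integral_const_real[of "1 :: complex" 0 1] by simp
next
  case False
  define w where "w = 2 * pi * \<i> * of_int n"
  have "w \<noteq> 0" using False by (simp add: w_def)
  have "((\<lambda>x. character (x * of_int n)) has_integral
      character (1 * of_int n) / w - character (0 * of_int n) / w) {0..1}"
  proof (rule fundamental_theorem_of_calculus)
    fix x :: real
    have "((\<lambda>x. character (x * of_int n) / w) has_vector_derivative w * character (x * of_int n) / w)
        (at x within {0..1})"
      using has_vector_derivative_character[of "of_int n"]
      by (intro has_vector_derivative_divide) (simp add: w_def)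
    then show "((\<lambda>x. character (x * of_int n) / w) has_vector_derivative character (x * of_int n))
        (at x within {0..1})"
      using \<open>w \<noteq> 0\<close> by simp
  qed simp
  then show ?thesis using False by (simp add: mult.commute)
qed

lemma bounded_linear_complex_real_decomposition:
  fixes f :: "complex \<Rightarrow> real"
  assumes "bounded_linear f"
  obtains \<alpha> where "\<And>z. of_real (f z) = \<alpha> * z + cnj \<alpha> * cnj z"
proof
  interpret bounded_linear f by fact
  fix z
  have "f z = f (Re z *\<^sub>R 1 + Im z *\<^sub>R \<i>)"
    by (rule arg_cong[where f = f]) (simp add: complex_eq_iff)
  also have "\<dots> = Re z * f 1 + Im z * f \<i>" by (simp only: add scaleR real_scaleR_def)
  finally show "complex_of_real (f z)
      = Complex (f 1 / 2) (- f \<i> / 2) * z + cnj (Complex (f 1 / 2) (- f \<i> / 2)) * cnj z"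
    by (simp add: complex_eq_iff algebra_simps)
qed

lemma polynomial_in_character_integral_eq_0:
  fixes D :: "real \<Rightarrow> complex" and f :: "complex \<Rightarrow> real"
  assumes "real_polynomial_function f"
    and "\<And>n. ((\<lambda>x. D x * character (of_int n * x)) has_integral 0) {0..1}"
  shows "((\<lambda>x. D x * f (character x) * character (of_int n * x)) has_integral 0) {0..1}"
  using assms
proof (induction f arbitrary: D n rule: real_polynomial_function.induct)
  case (linear f)
  obtain \<alpha> where \<alpha>: "\<And>z. of_real (f z) = \<alpha> * z + cnj \<alpha> * cnj z"
    using bounded_linear_complex_real_decomposition[OF linear(1)] by blast
  have "((\<lambda>x. \<alpha> * (D x * character (of_int (n + 1) * x)) + cnj \<alpha> * (D x * character (of_int (n - 1) * x)))
      has_integral (\<alpha> * 0 + cnj \<alpha> * 0)) {0..1}"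
    by (intro has_integral_add has_integral_mult_right linear)
  moreover have "\<alpha> * (D x * character (of_int (n + 1) * x)) + cnj \<alpha> * (D x * character (of_int (n - 1) * x))
      = D x * f (character x) * character (of_int n * x)" for x
    unfolding \<alpha> cnj_character by (simp add: algebra_simps flip: character_add)
  ultimately show ?case by simp
next
  case (const c)
  show ?case
    using has_integral_mult_right[OF const, of "of_real c"] by (simp add: mult_ac)
next
  case (add f g)
  then have "((\<lambda>x. D x * f (character x) * character (of_int n * x)
      + D x * g (character x) * character (of_int n * x))
      has_integral (0 + 0)) {0..1}"
    by (intro has_integral_add) auto
  then show ?case by (simp add: ring_distribs)
next
  case (mult f g)
  have "((\<lambda>x. D x * f (character x) * character (of_int m * x)) has_integral 0) {0..1}" for m
    by (intro mult)
  from mult.IH(2)[OF this] show ?case by (simp add: mult.assoc)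
qed

lemma periodic_factors_through_circle:
  fixes \<phi> :: "real \<Rightarrow> 'a::t2_space"
  assumes "continuous_on {0..1} \<phi>" "\<phi> 0 = \<phi> 1"
  obtains \<Phi> where "continuous_on (character ` {0..1}) \<Phi>" "\<And>x. x \<in> {0..1} \<Longrightarrow> \<Phi> (character x) = \<phi> x"
proof -
  have "x = y \<or> {x, y} = {0, 1}"
    if "x \<in> {0..1}" "y \<in> {0..1}" "character x = character y" for x y :: real
  proof -
    have "character (x - y) = 1" using that by (simp add: character_diff)
    then obtain n :: int where "x - y = of_int n"
      by (auto simp: character_eq_exp exp_eq_1)
    then have n: "x = y + of_int n" by simp
    then have "-1 \<le> n" "n \<le> 1" using that(1,2) by simp_all
    then consider "n = -1" | "n = 0" | "n = 1" by linarith
    then show ?thesis using that(1,2) n by cases auto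
  qed
  then have factors: "\<phi> x = \<phi> y" if "x \<in> {0..1}" "y \<in> {0..1}" "character x = character y" for x y
    using that assms(2) by (metis doubleton_eq_iff)
  have quotient: "quotient_map (top_of_set {0..1}) (top_of_set (character ` {0..1})) character"
  proof (rule T1_Spaces.continuous_imp_quotient_map)
    show "continuous_map (top_of_set {0..1}) (top_of_set (character ` {0..1})) character"
      by (simp add: continuous_map_in_subtopology continuous_on_character continuous_on_id)
    show "compact_space (top_of_set {0..1::real})"
      by (simp add: compact_space_subtopology)
  qed (simp_all add: Hausdorff_space_subtopology)
  obtain \<Phi> where "continuous_map (top_of_set (character ` {0..1})) euclidean \<Phi>"
    and "\<And>x. x \<in> topspace (top_of_set {0..1}) \<Longrightarrow> \<Phi> (character x) = \<phi> x"
  proof (rule quotient_map_lift_exists[OF quotient])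
    show "continuous_map (top_of_set {0..1}) euclidean \<phi>" using assms(1) by simp
    show "\<phi> x = \<phi> y" if "x \<in> topspace (top_of_set {0..1})" "y \<in> topspace (top_of_set {0..1})"
      "character x = character y" for x y
      by (rule factors) (use that in simp_all)
  qed blast
  then show ?thesis
    by (intro that) simp_all
qed

text \<open>A continuous \<open>\<phi>\<close> with \<open>\<phi> 0 = \<phi> 1\<close> is a function on the circle, hence by Stone--Weierstrass a uniform
  limit of polynomials in \<open>character\<close>.\<close>

lemma integral_mult_periodic_eq_0:
  fixes D :: "real \<Rightarrow> complex" and \<phi> :: "real \<Rightarrow> real"
  assumes D: "continuous_on {0..1} D"
    and coeff: "\<And>n. ((\<lambda>x. D x * character (of_int n * x)) has_integral 0) {0..1}"
    and \<phi>: "continuous_on {0..1} \<phi>" "\<phi> 0 = \<phi> 1"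
  shows "integral {0..1} (\<lambda>x. D x * \<phi> x) = 0"
proof -
  obtain \<Phi> where \<Phi>: "continuous_on (character ` {0..1}) \<Phi>" "\<And>x. x \<in> {0..1} \<Longrightarrow> \<Phi> (character x) = \<phi> x"
    using periodic_factors_through_circle[OF \<phi>] by blast
  have "compact (character ` {0..1})"
    by (intro compact_continuous_image continuous_intros) auto
  then obtain p where p: "uniform_limit (character ` {0..1}) p \<Phi> sequentially"
      "\<And>n. polynomial_function (p n)"
    using Stone_Weierstrass_uniform_limit[OF _ \<Phi>(1)] by metis
  have p_int: "((\<lambda>x. D x * p n (character x)) has_integral 0) {0..1}" for n
    using polynomial_in_character_integral_eq_0[OF _ coeff, of "p n" 0] p(2)
    by (simp add: real_polynomial_function_eq)
  have "uniform_limit {0..1} (\<lambda>n x. p n (character x)) (\<lambda>x. \<Phi> (character x)) sequentially"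
    using p(1) by (rule uniform_limit_compose') auto
  then have p_lim: "uniform_limit {0..1} (\<lambda>n x. p n (character x)) \<phi> sequentially"
    by (rule uniform_limit_cong'[THEN iffD1, rotated 2]) (use \<Phi>(2) in auto)
  have lim: "uniform_limit {0..1} (\<lambda>n x. D x * of_real (p n (character x)))
      (\<lambda>x. D x * of_real (\<phi> x)) sequentially"
  proof (rule uniform_lim_mult)
    show "uniform_limit {0..1} (\<lambda>n x. complex_of_real (p n (character x))) (\<lambda>x. of_real (\<phi> x)) sequentially"
      by (rule bounded_linear.uniform_limit[OF bounded_linear_of_real p_lim])
    show "bounded (D ` {0..1})" "bounded ((\<lambda>x. complex_of_real (\<phi> x)) ` {0..1})"
      by (intro compact_imp_bounded compact_continuous_image continuous_on_of_real compact_Icc D \<phi>(1))+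
  qed (rule uniform_limit_const)
  have cont: "continuous_on {0..1} (\<lambda>x. D x * p n (character x))" for n
  proof (intro continuous_on_mult D continuous_on_of_real)
    show "continuous_on {0..1} (\<lambda>x. p n (character x))"
      by (rule continuous_on_compose2[OF continuous_on_polymonial_function[OF p(2)] _ subset_UNIV])
        (intro continuous_intros)
  qed
  obtain I J where I: "\<And>n. ((\<lambda>x. D x * p n (character x)) has_integral I n) {0..1}"
    and J: "((\<lambda>x. D x * \<phi> x) has_integral J) {0..1}" "I \<longlonglongrightarrow> J"
    using uniform_limit_integral[OF lim cont] by auto
  have "I = (\<lambda>_. 0)" using has_integral_unique[OF I p_int] by blast
  then show ?thesis using J by (simp add: LIMSEQ_const_iff integral_unique)
qed

lemma fourier_uniqueness:
  fixes D :: "real \<Rightarrow> complex"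
  assumes D: "continuous_on {0..1} D"
    and coeff: "\<And>n. ((\<lambda>x. D x * character (of_int n * x)) has_integral 0) {0..1}"
    and x: "0 < x" "x < 1"
  shows "D x = 0"
proof -
  \<comment> \<open>The weight vanishes at both ends, so that \<open>D\<close> itself need not be periodic.\<close>
  let ?w = "\<lambda>x::real. x * (1 - x)"
  have "integral {0..1} (\<lambda>x. D x * of_real (?w x * Re (D x))) = 0"
    "integral {0..1} (\<lambda>x. D x * of_real (?w x * Im (D x))) = 0"
    by (intro integral_mult_periodic_eq_0 D coeff continuous_intros; simp)+
  moreover have "(\<lambda>x. D x * of_real (?w x * Re (D x))) integrable_on {0..1}"
     "(\<lambda>x. D x * of_real (?w x * Im (D x))) integrable_on {0..1}"
    by (intro integrable_continuous_interval continuous_intros D)+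
  ultimately have "((\<lambda>x. D x * of_real (?w x * Re (D x))
      - \<i> * (D x * of_real (?w x * Im (D x)))) has_integral 0 - \<i> * 0) {0..1}"
    by (intro has_integral_diff has_integral_mult_right) (metis integrable_integral)+
  moreover have "D x * of_real (?w x * Re (D x)) - \<i> * (D x * of_real (?w x * Im (D x)))
      = of_real (?w x * (norm (D x))\<^sup>2)" for x
  proof -
    have "D x * of_real (?w x * Re (D x)) - \<i> * (D x * of_real (?w x * Im (D x)))
        = of_real (?w x) * (D x * (of_real (Re (D x)) - \<i> * of_real (Im (D x))))"
      by (simp add: algebra_simps)
    also have "of_real (Re (D x)) - \<i> * of_real (Im (D x)) = cnj (D x)"
      by (simp add: complex_eq_iff)
    also have "D x * cnj (D x) = of_real ((norm (D x))\<^sup>2)"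
      by (simp only: complex_norm_square)
    finally show ?thesis by (simp only: of_real_mult)
  qed
  ultimately have "((\<lambda>x. complex_of_real (?w x * (norm (D x))\<^sup>2)) has_integral of_real 0) {0..1}"
    by simp
  then have "((\<lambda>x. ?w x * (norm (D x))\<^sup>2) has_integral 0) {0..1}"
    using has_integral_linear[OF _ bounded_linear_Re, of "\<lambda>x. of_real (?w x * (norm (D x))\<^sup>2)" "of_real 0"]
    by (simp only: o_def Re_complex_of_real)
  moreover have "continuous_on {0..1} (\<lambda>x. ?w x * (norm (D x))\<^sup>2)"
    by (intro continuous_intros D)
  ultimately have "?w x * (norm (D x))\<^sup>2 = 0"
    using x by (intro has_integral_0_cbox_imp_0[of 0 1]) (auto simp: box_real)
  then show ?thesis using x by simp
qed

section \<open>Integration of series and Poisson summation\<close>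

lemma continuous_on_infsum:
  fixes f :: "'i \<Rightarrow> 'a::topological_space \<Rightarrow> 'b::banach"
  assumes "\<And>i. i \<in> I \<Longrightarrow> continuous_on X (f i)"
    and "\<And>i x. i \<in> I \<Longrightarrow> x \<in> X \<Longrightarrow> norm (f i x) \<le> M i" "M summable_on I"
  shows "continuous_on X (\<lambda>x. \<Sum>\<^sub>\<infinity>i\<in>I. f i x)"
proof (rule uniform_limit_theorem)
  show "\<forall>\<^sub>F F in finite_subsets_at_top I. continuous_on X (\<lambda>x. \<Sum>i\<in>F. f i x)"
    using assms(1) by (intro eventually_finite_subsets_at_top_weakI continuous_on_sum) auto
  show "uniform_limit X (\<lambda>F x. \<Sum>i\<in>F. f i x) (\<lambda>x. \<Sum>\<^sub>\<infinity>i\<in>I. f i x) (finite_subsets_at_top I)"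
    using assms by (intro Weierstrass_m_test_general) auto
qed simp

lemma has_sum_integral_Icc:
  fixes f :: "'i \<Rightarrow> real \<Rightarrow> 'b::banach"
  assumes cont: "\<And>i. continuous_on {a..b} (f i)"
    and bound: "\<And>i x. x \<in> {a..b} \<Longrightarrow> norm (f i x) \<le> M i" "M summable_on UNIV"
  shows "((\<lambda>i. integral {a..b} (f i)) has_sum integral {a..b} (\<lambda>x. \<Sum>\<^sub>\<infinity>i. f i x)) UNIV"
proof -
  have "uniform_limit {a..b} (\<lambda>F x. \<Sum>i\<in>F. f i x) (\<lambda>x. \<Sum>\<^sub>\<infinity>i. f i x) (finite_subsets_at_top UNIV)"
    using bound by (intro Weierstrass_m_test_general) auto
  then obtain I J where I: "\<And>F. ((\<lambda>x. \<Sum>i\<in>F. f i x) has_integral I F) {a..b}"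
    and J: "((\<lambda>x. \<Sum>\<^sub>\<infinity>i. f i x) has_integral J) {a..b}" "(I \<longlongrightarrow> J) (finite_subsets_at_top UNIV)"
    by (rule uniform_limit_integral) (auto intro!: continuous_on_sum cont)
  have "I F = (\<Sum>i\<in>F. integral {a..b} (f i))" if "finite F" for F
    using that
    by (intro has_integral_unique[OF I] has_integral_sum integrable_integral
        integrable_continuous_interval cont)
  then have "((\<lambda>F. \<Sum>i\<in>F. integral {a..b} (f i)) \<longlongrightarrow> J) (finite_subsets_at_top UNIV)"
    using J(2) by (elim Lim_transform_eventually) (auto intro: eventually_finite_subsets_at_top_weakI)
  then show ?thesis
    using J(1) by (simp add: has_sum_def integral_unique)
qed

lemma integral_count_space_eq_infsum:
  fixes f :: "'i \<Rightarrow> 'b::{banach, second_countable_topology}"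
  assumes "(\<lambda>i. norm (f i)) summable_on A"
  shows "integrable (count_space A) f" "(\<integral>i. f i \<partial>count_space A) = (\<Sum>\<^sub>\<infinity>i\<in>A. f i)"
  using assms infsetsum_infsum[of f A]
  by (simp_all add: abs_summable_equivalent abs_summable_on_def infsetsum_def)

lemma borel_measurable_infsum:
  fixes f :: "'i::countable \<Rightarrow> 'a \<Rightarrow> 'b::{banach, second_countable_topology}"
  assumes "\<And>i. f i \<in> borel_measurable M" and summable: "\<And>x. (\<lambda>i. norm (f i x)) summable_on UNIV"
  shows "(\<lambda>x. \<Sum>\<^sub>\<infinity>i. f i x) \<in> borel_measurable M"
proof -
  interpret sigma_finite_measure "count_space (UNIV :: 'i set)"
    by (rule sigma_finite_measure_count_space)
  have "(\<lambda>(x, i). f i x) \<in> borel_measurable (M \<Otimes>\<^sub>M count_space UNIV)"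
    unfolding case_prod_beta'
    by (subst measurable_pair_swap_iff) (use assms(1) in \<open>auto intro!: measurable_pair_measure_countable1\<close>)
  then have "(\<lambda>x. \<integral>i. f i x \<partial>count_space UNIV) \<in> borel_measurable M"
    by (rule borel_measurable_lebesgue_integral)
  then show ?thesis by (simp only: integral_count_space_eq_infsum(2)[OF summable])
qed

lemma integral_infsum:
  fixes f :: "'i::countable \<Rightarrow> 'a \<Rightarrow> 'b::{banach, second_countable_topology}"
  assumes M: "sigma_finite_measure M"
    and f: "\<And>i. integrable M (f i)" "\<And>x. (\<lambda>i. norm (f i x)) summable_on UNIV"
    and norm_f: "(\<lambda>i. \<integral>x. norm (f i x) \<partial>M) summable_on UNIV"
  shows "integrable M (\<lambda>x. \<Sum>\<^sub>\<infinity>i. f i x)"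
    and "((\<lambda>i. integral\<^sup>L M (f i)) has_sum (\<integral>x. (\<Sum>\<^sub>\<infinity>i. f i x) \<partial>M)) UNIV"
proof -
  let ?N = "count_space (UNIV :: 'i set)"
  interpret pair_sigma_finite ?N M
    by (intro pair_sigma_finite.intro sigma_finite_measure_count_space M)
  have [measurable]: "case_prod f \<in> borel_measurable (?N \<Otimes>\<^sub>M M)"
    using f(1) by (intro measurable_pair_measure_countable1) (auto simp: borel_measurable_integrable)
  have product: "integrable (?N \<Otimes>\<^sub>M M) (case_prod f)"
  proof (rule Fubini_integrable)
    show "integrable ?N (\<lambda>i. \<integral>x. norm (case (i, x) of (i, x) \<Rightarrow> f i x) \<partial>M)"
      using norm_f by (simp add: integral_count_space_eq_infsum(1))
  qed (use f(1) in auto)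
  have infsum: "(\<integral>i. f i x \<partial>?N) = (\<Sum>\<^sub>\<infinity>i. f i x)" for x
    by (rule integral_count_space_eq_infsum(2)[OF f(2)])
  show "integrable M (\<lambda>x. \<Sum>\<^sub>\<infinity>i. f i x)"
    using integrable_snd[OF product] by (simp add: infsum)
  have norm_integral: "(\<lambda>i. norm (integral\<^sup>L M (f i))) summable_on UNIV"
    using norm_f by (rule summable_on_comparison_test) auto
  have "(\<integral>x. (\<Sum>\<^sub>\<infinity>i. f i x) \<partial>M) = (\<integral>i. integral\<^sup>L M (f i) \<partial>?N)"
    using Fubini_integral[OF product] by (simp add: infsum)
  also have "\<dots> = (\<Sum>\<^sub>\<infinity>i. integral\<^sup>L M (f i))"
    by (rule integral_count_space_eq_infsum(2)[OF norm_integral])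
  finally show "((\<lambda>i. integral\<^sup>L M (f i)) has_sum (\<integral>x. (\<Sum>\<^sub>\<infinity>i. f i x) \<partial>M)) UNIV"
    using abs_summable_summable[OF norm_integral] by simp
qed

lemma has_sum_integral_unit_intervals:
  fixes h :: "real \<Rightarrow> 'b::{banach, second_countable_topology}"
  assumes h: "integrable lborel h"
  shows "((\<lambda>m::int. LBINT x:{of_int m..<of_int m + 1}. h x) has_sum (\<integral>x. h x \<partial>lborel)) UNIV"
proof -
  define g where "g = (\<lambda>(m::int) x. indicator {of_int m..<of_int m + 1} x *\<^sub>R h x)"
  have g: "g m x = (if m = \<lfloor>x\<rfloor> then h x else 0)" for m x
    by (auto simp: g_def indicator_def floor_eq_iff) linarith+
  have g_sum: "((\<lambda>m. F (g m x)) has_sum F (h x)) UNIV"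
    if "F 0 = 0" for x and F :: "'b \<Rightarrow> 'c::{comm_monoid_add, topological_space}"
    using that by (intro has_sum_finite_neutralI[of "{\<lfloor>x\<rfloor>}"]) (auto simp: g)
  have g_int: "integrable lborel (g m)" for m
    unfolding g_def by (intro integrable_mult_indicator h) auto
  have "(\<Sum>m\<in>F. \<integral>x. norm (g m x) \<partial>lborel) \<le> (\<integral>x. norm (h x) \<partial>lborel)" if "finite F" for F
  proof -
    have "(\<Sum>m\<in>F. \<integral>x. norm (g m x) \<partial>lborel) = (\<integral>x. (\<Sum>m\<in>F. norm (g m x)) \<partial>lborel)"
      using g_int by (subst Bochner_Integration.integral_sum) auto
    also have "\<dots> \<le> (\<integral>x. norm (h x) \<partial>lborel)"
    proof (rule Bochner_Integration.integral_mono)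
      show "(\<Sum>m\<in>F. norm (g m x)) \<le> norm (h x)" for x
        using that by (auto simp: g if_distrib[of norm] cong: if_cong)
    qed (use g_int h in auto)
    finally show ?thesis .
  qed
  then have "(\<lambda>m. \<integral>x. norm (g m x) \<partial>lborel) summable_on UNIV"
    by (intro nonneg_bdd_above_summable_on bdd_aboveI2) auto
  then have "((\<lambda>m. integral\<^sup>L lborel (g m)) has_sum (\<integral>x. (\<Sum>\<^sub>\<infinity>m. g m x) \<partial>lborel)) UNIV"
    using g_int g_sum[of norm]
    by (intro integral_infsum lborel.sigma_finite_measure_axioms) (auto simp: summable_on_def)
  moreover have "(\<Sum>\<^sub>\<infinity>m. g m x) = h x" for x
    using g_sum[of "\<lambda>y. y"] by (intro infsumI) simp
  ultimately show ?thesis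
    by (simp add: g_def set_lebesgue_integral_def)
qed

locale periodization =
  fixes h :: "real \<Rightarrow> complex" and M :: "int \<Rightarrow> real"
  assumes continuous: "continuous_on UNIV h"
    and integrable: "integrable lborel h"
    and norm_le: "\<And>m x. x \<in> {0..1} \<Longrightarrow> norm (h (of_int m + x)) \<le> M m"
    and majorant: "M summable_on UNIV"
begin

lemma continuous_on_periodization: "continuous_on {0..1} (\<lambda>x. \<Sum>\<^sub>\<infinity>m::int. h (of_int m + x))"
  by (intro continuous_on_infsum[OF _ norm_le majorant]
      continuous_on_compose2[OF continuous] continuous_intros) auto

lemma has_integral_periodization:
  "((\<lambda>x. \<Sum>\<^sub>\<infinity>m::int. h (of_int m + x)) has_integral (\<integral>x. h x \<partial>lborel)) {0..1}"
proof -
  have "(LBINT x:{of_int m..<of_int m + 1}. h x) = integral {0..1} (\<lambda>x. h (of_int m + x))" for m :: int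
  proof -
    have "set_integrable lborel {of_int m..<of_int m + 1} h"
      unfolding set_integrable_def by (intro integrable_mult_indicator integrable) auto
    then have "(LBINT x:{of_int m..<of_int m + 1}. h x) = integral {of_int m..<of_int m + 1} h"
      by (rule set_borel_integral_eq_integral)
    also have "\<dots> = integral {0 + of_int m..1 + of_int m} h"
      by (rule integral_spike_set; rule negligible_subset[OF negligible_sing[of "of_int m + 1"]]; auto)
    also have "\<dots> = integral {0..1} (\<lambda>x. h (of_int m + x))"
      by (simp only: integral_shift_Icc_real[symmetric] o_def)
    finally show ?thesis .
  qed
  then have "((\<lambda>m. integral {0..1} (\<lambda>x. h (of_int m + x))) has_sum (\<integral>x. h x \<partial>lborel)) UNIV"
    using has_sum_integral_unit_intervals[OF integrable] by (simp only:)
  moreover have "((\<lambda>m. integral {0..1} (\<lambda>x. h (of_int m + x))) has_sum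
      integral {0..1} (\<lambda>x. \<Sum>\<^sub>\<infinity>m::int. h (of_int m + x))) UNIV"
    by (intro has_sum_integral_Icc[OF _ norm_le majorant]
        continuous_on_compose2[OF continuous] continuous_intros) auto
  ultimately have "integral {0..1} (\<lambda>x. \<Sum>\<^sub>\<infinity>m::int. h (of_int m + x)) = (\<integral>x. h x \<partial>lborel)"
    by (rule has_sum_unique[rotated])
  then show ?thesis
    using integrable_continuous_interval[OF continuous_on_periodization] by (simp add: has_integral_iff)
qed

end

lemma fourier_series_coefficient:
  fixes w :: "int \<Rightarrow> complex"
  assumes "(\<lambda>n. norm (w n)) summable_on UNIV"
  shows "((\<lambda>x. (\<Sum>\<^sub>\<infinity>n. w n * character (of_int n * x)) * character (of_int m * x))
      has_integral w (- m)) {0..1}"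
proof -
  let ?f = "\<lambda>n x. w n * character (of_int (n + m) * x)"
  have series: "(\<Sum>\<^sub>\<infinity>n. w n * character (of_int n * x)) * character (of_int m * x)
      = (\<Sum>\<^sub>\<infinity>n. ?f n x)" for x
    by (subst infsum_cmult_left'[symmetric]) (simp add: ring_distribs character_add mult_ac)
  have "continuous_on {0..1} (\<lambda>x. \<Sum>\<^sub>\<infinity>n. ?f n x)"
    by (rule continuous_on_infsum[OF _ _ assms]) (auto intro!: continuous_intros simp: norm_mult)
  then have integrable: "(\<lambda>x. \<Sum>\<^sub>\<infinity>n. ?f n x) integrable_on {0..1}"
    by (rule integrable_continuous_interval)
  have "integral {0..1} (?f n) = w n * (if n + m = 0 then 1 else 0)" for n
    by (intro integral_unique has_integral_mult_right has_integral_character_of_int)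
  also have "w n * (if n + m = 0 then 1 else 0) = (if n = - m then w (- m) else 0)" for n
    by (auto simp: add_eq_0_iff2)
  finally have "integral {0..1} (?f n) = (if n = - m then w (- m) else 0)" for n .
  moreover have "((\<lambda>n. integral {0..1} (?f n)) has_sum integral {0..1} (\<lambda>x. \<Sum>\<^sub>\<infinity>n. ?f n x)) UNIV"
    by (rule has_sum_integral_Icc[OF _ _ assms]) (auto intro!: continuous_intros simp: norm_mult)
  ultimately have "((\<lambda>n. if n = - m then w (- m) else 0) has_sum integral {0..1} (\<lambda>x. \<Sum>\<^sub>\<infinity>n. ?f n x)) UNIV"
    by simp
  moreover have "((\<lambda>n. if n = - m then w (- m) else 0) has_sum w (- m)) UNIV"
    by (rule has_sum_finite_neutralI[of "{- m}"]) auto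
  ultimately have "integral {0..1} (\<lambda>x. \<Sum>\<^sub>\<infinity>n. ?f n x) = w (- m)"
    by (rule has_sum_unique)
  then show ?thesis using integrable by (simp add: series has_integral_iff)
qed

definition fourier_transform :: "(real \<Rightarrow> complex) \<Rightarrow> real \<Rightarrow> complex" where
  "fourier_transform h y = (\<integral>x. h x * character (- (x * y)) \<partial>lborel)"

theorem (in periodization) poisson_summation:
  assumes summable: "(\<lambda>n::int. norm (fourier_transform h (of_int n))) summable_on UNIV" and x: "0 < x" "x < 1"
  shows "(\<Sum>\<^sub>\<infinity>m::int. h (of_int m + x))
      = (\<Sum>\<^sub>\<infinity>n::int. fourier_transform h (of_int n) * character (of_int n * x))"
proof -
  let ?P = "\<lambda>x. \<Sum>\<^sub>\<infinity>m::int. h (of_int m + x)"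
  let ?Q = "\<lambda>x. \<Sum>\<^sub>\<infinity>n::int. fourier_transform h (of_int n) * character (of_int n * x)"
  have "?P x - ?Q x = 0"
  proof (rule fourier_uniqueness[of "\<lambda>x. ?P x - ?Q x"])
    have "continuous_on {0..1} ?Q"
      by (rule continuous_on_infsum[OF _ _ summable]) (auto intro!: continuous_intros simp: norm_mult)
    then show "continuous_on {0..1} (\<lambda>x. ?P x - ?Q x)"
      by (intro continuous_intros continuous_on_periodization)
    fix n :: int
    interpret twist: periodization "\<lambda>x. h x * character (of_int n * x)" M
    proof
      show "integrable lborel (\<lambda>x. h x * character (of_int n * x))"
        by (rule Bochner_Integration.integrable_bound[OF integrable])
          (use integrable in \<open>auto simp: norm_mult borel_measurable_integrable\<close>)
    qed (auto intro!: continuous_intros continuous norm_le majorant simp: norm_mult)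
    have "character (of_int n * (of_int m + y)) = character (of_int n * y)" for m y
      using character_of_int[of "n * m"] by (simp add: ring_distribs character_add)
    then have "((\<lambda>x. ?P x * character (of_int n * x))
        has_integral fourier_transform h (of_int (- n))) {0..1}"
      using twist.has_integral_periodization
      by (simp add: fourier_transform_def infsum_cmult_left' mult.commute[of "of_int n"])
    moreover have "((\<lambda>x. ?Q x * character (of_int n * x))
        has_integral fourier_transform h (of_int (- n))) {0..1}"
      by (rule fourier_series_coefficient[OF summable])
    ultimately show "((\<lambda>x. (?P x - ?Q x) * character (of_int n * x)) has_integral 0) {0..1}"
      unfolding left_diff_distrib by (rule has_integral_diff[where k = k and l = k for k, simplified])
  qed (use x in auto)
  then show ?thesis by simp
qed

section \<open>Gaussians and theta series\<close>

definition gaussian :: "nat \<Rightarrow> real \<Rightarrow> real \<Rightarrow> real" where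
  "gaussian k t x = x ^ k * exp (- (pi * t * x\<^sup>2))"

lemma continuous_on_gaussian [continuous_intros]:
  "continuous_on A f \<Longrightarrow> continuous_on A (\<lambda>x. gaussian k t (f x))"
  unfolding gaussian_def by (intro continuous_intros)

lemma gaussian_measurable [measurable]: "gaussian k t \<in> borel_measurable borel"
  by (intro borel_measurable_continuous_onI continuous_intros)

lemma gaussian_abs: "gaussian k t \<bar>x\<bar> = \<bar>gaussian k t x\<bar>"
  by (simp add: gaussian_def abs_mult power_abs)

lemma gaussian_minus: "gaussian k t (- x) = (- 1) ^ k * gaussian k t x"
  unfolding gaussian_def by (subst power_minus) simp

lemma integrable_gaussian:
  assumes "t > 0"
  shows "integrable lborel (gaussian k t)"
proof -
  define \<sigma> where "\<sigma> = 1 / sqrt (2 * pi * t)"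
  have \<sigma>: "\<sigma> > 0" "\<sigma>\<^sup>2 = 1 / (2 * pi * t)"
    using assms by (simp_all add: \<sigma>_def power_divide)
  have "gaussian k t = (\<lambda>x. 1 / sqrt t * (normal_density 0 \<sigma> x * (x - 0) ^ k))"
    using assms by (simp add: fun_eq_iff gaussian_def normal_density_def \<sigma>(2) real_sqrt_divide)
  then show ?thesis
    by (simp only:) (intro integrable_mult_right integrable_normal_moment \<sigma>(1))
qed

lemma integrable_gaussian_character:
  assumes "t > 0"
  shows "integrable lborel (\<lambda>x. of_real (gaussian k t x) * character (- (x * y)))"
  by (rule Bochner_Integration.integrable_bound[OF integrable_gaussian[OF assms, of k]])
    (simp_all add: norm_mult)

lemma abs_gaussian_le:
  assumes x: "1 \<le> \<bar>x\<bar>" and t: "t > 0" and k: "k \<le> 2"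
  shows "\<bar>gaussian k t x\<bar> \<le> exp (- t) / t\<^sup>2 * inverse (x\<^sup>2)"
proof -
  define y where "y = t * x\<^sup>2"
  have x_sq_ge_1: "1 \<le> x\<^sup>2" using x by (metis abs_1 abs_le_square_iff power_one)
  have y: "t \<le> y" using x_sq_ge_1 t mult_left_mono[of 1 "x\<^sup>2" t] by (simp add: y_def)
  have "3 * y \<le> pi * y" using pi_gt3 y t by (intro mult_right_mono) auto
  then have "exp (- (pi * y)) \<le> exp (- t) * exp (- (2 * y))"
    using y by (simp flip: exp_add)
  also have "\<dots> \<le> exp (- t) * inverse (y\<^sup>2)"
  proof (intro mult_left_mono)
    have "y\<^sup>2 \<le> (2 * y)\<^sup>2 / 2" by (simp add: power_mult_distrib)
    also have "\<dots> \<le> exp (2 * y)" using exp_lower_Taylor_quadratic[of "2 * y"] y t by simp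
    finally show "exp (- (2 * y)) \<le> inverse (y\<^sup>2)"
      using y t by (simp add: exp_minus le_imp_inverse_le)
  qed simp
  finally have exp_le: "exp (- (pi * y)) \<le> exp (- t) * inverse (y\<^sup>2)" .
  have "\<bar>x\<bar> ^ k \<le> x\<^sup>2" using power_increasing[of k 2 "\<bar>x\<bar>"] x k by simp
  then have "\<bar>x\<bar> ^ k * exp (- (pi * y)) \<le> x\<^sup>2 * (exp (- t) * inverse (y\<^sup>2))"
    using exp_le by (intro mult_mono) auto
  also have "\<dots> = exp (- t) / t\<^sup>2 * inverse (x\<^sup>2)"
    using x_sq_ge_1 t by (auto simp: y_def power2_eq_square field_simps)
  finally show ?thesis
    by (simp add: gaussian_def y_def abs_mult power_abs mult.assoc)
qed

lemma abs_gaussian_le_1: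
  assumes "\<bar>x\<bar> \<le> 1" "t \<ge> 0"
  shows "\<bar>gaussian k t x\<bar> \<le> 1"
  using mult_mono[of "\<bar>x\<bar> ^ k" 1 "exp (- (pi * t * x\<^sup>2))" 1] assms
  by (simp add: gaussian_def abs_mult power_abs power_le_one)

lemma integral_derivative_eq_0:
  fixes F f :: "real \<Rightarrow> complex"
  assumes F: "\<And>x. (F has_vector_derivative f x) (at x)" "(F \<longlongrightarrow> 0) at_top" "(F \<longlongrightarrow> 0) at_bot"
    and f: "continuous_on UNIV f" "integrable lborel f"
  shows "(\<integral>x. f x \<partial>lborel) = 0"
proof -
  have "(LBINT x=-\<infinity>..\<infinity>. f x) = 0 - 0"
    using assms by (intro interval_integral_FTC_integrable[where F = F])
      (auto simp: ereal_tendsto_simps set_integrable_def continuous_on_eq_continuous_at)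
  then show ?thesis
    by (simp add: interval_lebesgue_integral_def set_lebesgue_integral_def)
qed

lemma fourier_transform_gaussian_0:
  assumes t: "t > 0"
  shows "fourier_transform (\<lambda>x. of_real (gaussian 0 t x)) y = of_real (gaussian 0 (1 / t) y / sqrt t)"
proof -
  define s where "s = sqrt (2 * pi * t)"
  define \<tau> where "\<tau> = - (2 * pi * y) / s"
  have s: "s > 0" "s\<^sup>2 = 2 * pi * t" using t by (simp_all add: s_def)
  have "(s * x)\<^sup>2 / 2 = pi * t * x\<^sup>2" for x by (simp add: power_mult_distrib s(2))
  then have density: "std_normal_density (s * x) = gaussian 0 t x / sqrt (2 * pi)" for x
    by (simp add: std_normal_density_def gaussian_def)
  have "\<tau> * (s * x) = 2 * pi * (- (x * y))" for x using s(1) by (simp add: \<tau>_def)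
  then have "std_normal_density (s * x) *\<^sub>R iexp (\<tau> * (s * x))
      = of_real (gaussian 0 t x) * character (- (x * y)) / sqrt (2 * pi)" for x
    by (simp only: density character_def cis_conv_exp) (simp add: scaleR_conv_of_real)
  moreover have "of_real (exp (- \<tau>\<^sup>2 / 2)) = (\<integral>x. std_normal_density x *\<^sub>R iexp (\<tau> * x) \<partial>lborel)"
    using fun_cong[OF char_std_normal_distribution, of \<tau>]
    by (simp add: char_def integral_density)
  moreover have "\<dots> = s *\<^sub>R (\<integral>x. std_normal_density (s * x) *\<^sub>R iexp (\<tau> * (s * x)) \<partial>lborel)"
    using s(1) by (subst lborel_integral_real_affine[of s _ 0]) auto
  ultimately have "of_real (exp (- \<tau>\<^sup>2 / 2))
      = s *\<^sub>R (fourier_transform (\<lambda>x. of_real (gaussian 0 t x)) y / sqrt (2 * pi))"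
    by (simp add: fourier_transform_def)
  moreover have "\<tau>\<^sup>2 / 2 = pi * (1 / t) * y\<^sup>2"
    using t s by (simp add: \<tau>_def power_divide power_mult_distrib) (simp add: power2_eq_square)
  moreover have "s / sqrt (2 * pi) = sqrt t" by (simp add: s_def real_sqrt_mult)
  ultimately show ?thesis
    using t by (simp add: gaussian_def scaleR_conv_of_real field_simps)
qed

lemma fourier_transform_gaussian_1:
  assumes t: "t > 0"
  shows "fourier_transform (\<lambda>x. of_real (gaussian 1 t x)) y
      = - \<i> * of_real (gaussian 1 (1 / t) y / (t * sqrt t))"
proof -
  define wave where "wave = (\<lambda>k x. of_real (gaussian k t x) * character (- (x * y)))"
  have wave_int: "integrable lborel (wave k)" for k
    unfolding wave_def by (rule integrable_gaussian_character[OF t])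
  define I where "I = (\<lambda>k. integral\<^sup>L lborel (wave k))"
  have I_transform: "I k = fourier_transform (\<lambda>x. of_real (gaussian k t x)) y" for k
    by (simp add: I_def wave_def fourier_transform_def)
  let ?f = "\<lambda>x. - (2 * pi * t) * wave 1 x + - (2 * pi * \<i> * y) * wave 0 x"
  have "(\<integral>x. ?f x \<partial>lborel) = 0"
  proof (rule integral_derivative_eq_0)
    fix x
    have "((\<lambda>x. complex_of_real (gaussian 0 t x))
        has_vector_derivative of_real (- (2 * pi * t) * gaussian 1 t x)) (at x)"
      unfolding gaussian_def
      by (intro has_vector_derivative_of_real) (auto intro!: derivative_eq_intros)
    from has_vector_derivative_mult[OF this has_vector_derivative_character[of "- y" x]]
    show "(wave 0 has_vector_derivative ?f x) (at x)"
      by (simp add: wave_def algebra_simps)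
  next
    have "norm (wave 0 x) = exp (- (pi * t * x\<^sup>2))" for x
      by (simp add: wave_def norm_mult gaussian_def)
    then show "(wave 0 \<longlongrightarrow> 0) at_top" "(wave 0 \<longlongrightarrow> 0) at_bot"
      unfolding tendsto_norm_zero_iff[symmetric, of "wave 0"] using t by (simp only:, real_asymp)+
    show "continuous_on UNIV ?f"
      unfolding wave_def by (intro continuous_intros)
  qed (intro Bochner_Integration.integrable_add integrable_mult_right wave_int)
  moreover have "(\<integral>x. ?f x \<partial>lborel) = - (2 * pi * t) * I 1 + - (2 * pi * \<i> * y) * I 0"
    unfolding I_def using wave_int by (subst Bochner_Integration.integral_add) simp_all
  ultimately have "- (2 * pi) * (t * I 1 + \<i> * y * I 0) = 0"
    by (simp only:) (simp add: ring_distribs mult.assoc)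
  then have "t * I 1 = - \<i> * y * I 0"
    by (simp add: add_eq_0_iff2)
  then have "I 1 = - \<i> * y / t * I 0"
    using t by (simp add: field_simps)
  then show ?thesis
    unfolding I_transform fourier_transform_gaussian_0[OF t] by (simp add: gaussian_def)
qed

lemma fourier_transform_gaussian:
  assumes "t > 0" "k \<le> 1"
  shows "fourier_transform (\<lambda>x. of_real (gaussian k t x)) y
      = (- \<i> / t) ^ k / sqrt t * gaussian k (1 / t) y"
proof -
  consider "k = 0" | "k = 1" using assms(2) by linarith
  then show ?thesis
    by cases (use fourier_transform_gaussian_0[OF assms(1), of y]
        fourier_transform_gaussian_1[OF assms(1), of y] in simp_all)
qed

lemma summable_on_int_of_nat_abs:
  fixes f :: "nat \<Rightarrow> real"
  assumes "f summable_on UNIV"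
  shows "(\<lambda>n::int. f (nat \<bar>n\<bar>)) summable_on UNIV"
proof -
  have "(\<lambda>n::int. f (nat \<bar>n\<bar>)) summable_on range int"
      and "(\<lambda>n::int. f (nat \<bar>n\<bar>)) summable_on range (\<lambda>n. - int n)"
    by (subst summable_on_reindex; use assms in \<open>simp add: o_def inj_on_def\<close>)+
  then have "(\<lambda>n::int. f (nat \<bar>n\<bar>)) summable_on range int \<union> range (\<lambda>n. - int n)"
    by (rule summable_on_union)
  also have "range int \<union> range (\<lambda>n. - int n) = UNIV"
    by (auto, metis int_cases2 rangeI)
  finally show ?thesis .
qed

lemma summable_on_comparison_cofinite:
  fixes f g :: "'i \<Rightarrow> real"
  assumes "g summable_on UNIV" "finite F" "\<And>i. i \<notin> F \<Longrightarrow> f i \<le> g i" "\<And>i. 0 \<le> f i"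
  shows "f summable_on UNIV"
proof -
  have "g summable_on (- F)" using assms(1) by (rule summable_on_subset_banach) simp
  then have "f summable_on (- F)" by (rule summable_on_comparison_test) (use assms(3,4) in auto)
  moreover have "f summable_on F" using assms(2) by (rule summable_on_finite)
  ultimately show ?thesis by (metis Compl_partition2 summable_on_union)
qed

lemma abs_int_add_unit_interval_ge:
  fixes c :: real and n :: int
  assumes "n \<notin> {0, -1}" "0 \<le> c" "c \<le> 1"
  shows "1 \<le> \<bar>of_int n + c\<bar>" "\<bar>of_int n\<bar> / 2 \<le> \<bar>of_int n + c\<bar>"
proof -
  consider "n \<ge> 1" | "n \<le> -2" using assms(1) by force
  then have "1 \<le> \<bar>of_int n + c\<bar> \<and> \<bar>of_int n\<bar> / 2 \<le> \<bar>of_int n + c\<bar>"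
  proof cases
    assume "n \<ge> 1"
    then have "real_of_int n \<ge> 1" by simp
    then show ?thesis using assms by simp
  next
    assume "n \<le> -2"
    then have "real_of_int n \<le> -2" by simp
    then show ?thesis using assms by (simp add: abs_if)
  qed
  then show "1 \<le> \<bar>of_int n + c\<bar>" "\<bar>of_int n\<bar> / 2 \<le> \<bar>of_int n + c\<bar>" by auto
qed

lemma summable_on_int_add_powr:
  fixes r c :: real
  assumes "r > 1" "0 \<le> c" "c \<le> 1"
  shows "(\<lambda>n::int. \<bar>of_int n + c\<bar> powr (- r)) summable_on UNIV"
proof (rule summable_on_comparison_cofinite[where F = "{0,-1}"])
  have "(\<lambda>n. 2 powr r * real n powr (- r)) summable_on UNIV"
    using assms(1)
    by (intro summable_on_cmult_right norm_summable_imp_summable_on) (simp add: summable_real_powr_iff)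
  then show "(\<lambda>n::int. 2 powr r * real (nat \<bar>n\<bar>) powr (- r)) summable_on UNIV"
    by (rule summable_on_int_of_nat_abs)
  fix n :: int assume n: "n \<notin> {0,-1}"
  have "\<bar>of_int n + c\<bar> powr (- r) \<le> (\<bar>of_int n\<bar> / 2) powr (- r)"
    using abs_int_add_unit_interval_ge[OF n assms(2,3)] n assms(1) by (intro powr_mono2') auto
  then show "\<bar>of_int n + c\<bar> powr (- r) \<le> 2 powr r * real (nat \<bar>n\<bar>) powr (- r)"
    by (simp add: powr_divide powr_minus field_simps)
qed auto

definition theta_term :: "nat \<Rightarrow> real \<Rightarrow> real \<Rightarrow> real \<Rightarrow> int \<Rightarrow> complex" where
  "theta_term k t a c n = gaussian k t (of_int n + c) * character (of_int n * a)"

definition theta :: "nat \<Rightarrow> real \<Rightarrow> real \<Rightarrow> real \<Rightarrow> complex" where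
  "theta k t a c = (\<Sum>\<^sub>\<infinity>n. theta_term k t a c n)"

lemma norm_theta_term: "norm (theta_term k t a c n) = \<bar>gaussian k t (of_int n + c)\<bar>"
  by (simp add: theta_term_def norm_mult)

lemma norm_theta_term_le:
  assumes "n \<notin> {0, -1}" "0 \<le> c" "c \<le> 1" "t > 0" "k \<le> 1"
  shows "norm (theta_term k t a c n) \<le> exp (- t) / t\<^sup>2 * (4 * inverse ((of_int n)\<^sup>2))"
proof -
  have "(\<bar>of_int n\<bar> / 2)\<^sup>2 \<le> \<bar>of_int n + c\<bar>\<^sup>2"
    using abs_int_add_unit_interval_ge[OF assms(1-3)] by (intro power_mono) auto
  then have "inverse (\<bar>of_int n + c\<bar>\<^sup>2) \<le> inverse ((\<bar>of_int n\<bar> / 2)\<^sup>2)"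
    using assms(1) by (intro le_imp_inverse_le) auto
  also have "\<dots> = 4 * inverse ((of_int n)\<^sup>2)"
    by (simp add: power_divide field_simps)
  finally have "exp (- t) / t\<^sup>2 * inverse ((of_int n + c)\<^sup>2)
      \<le> exp (- t) / t\<^sup>2 * (4 * inverse ((of_int n)\<^sup>2))"
    by (intro mult_left_mono) auto
  moreover have "\<bar>gaussian k t (of_int n + c)\<bar> \<le> exp (- t) / t\<^sup>2 * inverse ((of_int n + c)\<^sup>2)"
    using abs_int_add_unit_interval_ge(1)[OF assms(1-3)] assms(4,5) by (intro abs_gaussian_le) auto
  ultimately show ?thesis unfolding norm_theta_term by linarith
qed

lemma summable_on_int_inverse_square: "(\<lambda>n::int. 4 * inverse ((real_of_int n)\<^sup>2)) summable_on UNIV"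
proof -
  have "(\<lambda>n. 4 * inverse ((real n)\<^sup>2)) summable_on UNIV"
    by (intro summable_on_cmult_right norm_summable_imp_summable_on) (simp add: inverse_power_summable)
  from summable_on_int_of_nat_abs[OF this] show ?thesis by simp
qed

definition theta_majorant :: "real \<Rightarrow> int \<Rightarrow> real" where
  "theta_majorant t n = (if n \<in> {0, -1} then 1 else exp (- t) / t\<^sup>2 * (4 * inverse ((of_int n)\<^sup>2)))"

lemma theta_majorant_summable: "theta_majorant t summable_on UNIV"
  by (rule summable_on_comparison_cofinite[where F = "{0,-1}",
        OF summable_on_cmult_right[OF summable_on_int_inverse_square, of "exp (- t) / t\<^sup>2"]])
    (auto simp: theta_majorant_def)

lemma norm_theta_term_le_majorant:
  assumes "0 \<le> c" "c \<le> 1" "t > 0" "k \<le> 1"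
  shows "norm (theta_term k t a c n) \<le> theta_majorant t n"
proof (cases "n \<in> {0, -1}")
  case True
  then have "\<bar>gaussian k t (of_int n + c)\<bar> \<le> 1"
    using assms by (intro abs_gaussian_le_1) auto
  then show ?thesis using True by (simp add: norm_theta_term theta_majorant_def)
next
  case False
  then show ?thesis using norm_theta_term_le[OF False assms] by (simp add: theta_majorant_def)
qed

lemma theta_term_abs_summable:
  assumes "0 \<le> c" "c \<le> 1" "t > 0" "k \<le> 1"
  shows "(\<lambda>n. norm (theta_term k t a c n)) summable_on UNIV"
  by (rule summable_on_comparison_test[OF theta_majorant_summable[of t]])
    (use norm_theta_term_le_majorant[OF assms] in auto)

definition theta_near :: "nat \<Rightarrow> real \<Rightarrow> real \<Rightarrow> real \<Rightarrow> complex" where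
  "theta_near k t a c = theta_term k t a c 0 + theta_term k t a c (-1)"

definition theta_tail_const :: real where
  "theta_tail_const = (\<Sum>\<^sub>\<infinity>n::int. 4 * inverse ((real_of_int n)\<^sup>2))"

lemma theta_tail_const_nonneg: "0 \<le> theta_tail_const"
  unfolding theta_tail_const_def by (intro infsum_nonneg) auto

lemma norm_theta_minus_near_le:
  assumes "0 \<le> c" "c \<le> 1" "t \<ge> 1" "k \<le> 1"
  shows "norm (theta k t a c - theta_near k t a c) \<le> theta_tail_const * exp (- t)"
proof -
  let ?tail = "- {0, -1} :: int set"
  have summable: "(\<lambda>n. norm (theta_term k t a c n)) summable_on A" for A
    using theta_term_abs_summable[of c t k a] assms summable_on_subset_banach by fastforce
  have "theta k t a c = infsum (theta_term k t a c) ({0,-1} \<union> ?tail)"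
    by (simp add: theta_def)
  also have "\<dots> = infsum (theta_term k t a c) {0,-1} + infsum (theta_term k t a c) ?tail"
    by (intro infsum_Un_disjoint abs_summable_summable[OF summable]) auto
  finally have "theta k t a c - theta_near k t a c = infsum (theta_term k t a c) ?tail"
    by (simp add: theta_near_def)
  also have "norm \<dots> \<le> infsum (\<lambda>n. norm (theta_term k t a c n)) ?tail"
    by (intro norm_infsum_bound summable)
  also have "\<dots> \<le> infsum (\<lambda>n. exp (- t) * (4 * inverse ((of_int n)\<^sup>2))) UNIV"
  proof (intro infsum_mono_neutral summable summable_on_cmult_right[OF summable_on_int_inverse_square])
    fix n assume "n \<in> ?tail \<inter> UNIV"
    then have "norm (theta_term k t a c n) \<le> exp (- t) / t\<^sup>2 * (4 * inverse ((of_int n)\<^sup>2))"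
      using assms by (intro norm_theta_term_le) auto
    also have "\<dots> \<le> exp (- t) * (4 * inverse ((of_int n)\<^sup>2))"
      using assms(3) by (intro mult_right_mono) (auto simp: divide_le_eq)
    finally show "norm (theta_term k t a c n) \<le> exp (- t) * (4 * inverse ((of_int n)\<^sup>2))" .
  qed auto
  also have "\<dots> = theta_tail_const * exp (- t)"
    by (simp only: theta_tail_const_def infsum_cmult_right' mult.commute)
  finally show ?thesis .
qed

lemma theta_reflect: "theta k t (1 - a) (1 - c) = (- 1) ^ k * character a * theta k t a c"
proof -
  have "theta_term k t (1 - a) (1 - c) (- n - 1) = (- 1) ^ k * character a * theta_term k t a c n" for n
  proof -
    have "character (of_int (- n - 1) * (1 - a))
        = character (of_int (- n - 1)) * character (a + of_int n * a)"
      by (simp add: algebra_simps flip: character_add)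
    then have "character (of_int (- n - 1) * (1 - a)) = character a * character (of_int n * a)"
      by (simp only: character_of_int character_add mult_1)
    moreover have "real_of_int (- n - 1) + (1 - c) = - (of_int n + c)" by simp
    ultimately show ?thesis
      by (simp only: theta_term_def gaussian_minus) simp
  qed
  moreover have "(\<Sum>\<^sub>\<infinity>n. theta_term k t (1 - a) (1 - c) (- n - 1)) = theta k t (1 - a) (1 - c)"
    unfolding theta_def
    by (rule infsum_reindex_bij_betw) (auto intro!: bij_betwI[where g = "\<lambda>n. - n - 1"])
  ultimately show ?thesis by (simp only: theta_def infsum_cmult_right')
qed

theorem theta_transformation:
  fixes a c t :: real
  assumes a: "0 < a" "a < 1" and c: "0 \<le> c" "c \<le> 1" and t: "t > 0" and k: "k \<le> 1"
  shows "character (- (a * c)) * theta k t (1 - c) a = (- \<i> / t) ^ k / sqrt t * theta k (1 / t) a c"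
proof -
  let ?h = "\<lambda>x. of_real (gaussian k t x) * character (- (x * c))"
  interpret periodization ?h "theta_majorant t"
  proof
    show "integrable lborel ?h" by (rule integrable_gaussian_character[OF t])
    show "norm (?h (of_int m + x)) \<le> theta_majorant t m" if "x \<in> {0..1}" for m x
      using norm_theta_term_le_majorant[of x t k c m] that t k by (simp add: norm_theta_term norm_mult)
  qed (auto intro!: continuous_intros theta_majorant_summable)
  have "fourier_transform ?h y = fourier_transform (\<lambda>x. of_real (gaussian k t x)) (y + c)" for y
    by (simp add: fourier_transform_def ring_distribs mult.assoc add.commute flip: character_add)
  then have transform: "fourier_transform ?h (of_int n) * character (of_int n * a)
      = (- \<i> / t) ^ k / sqrt t * theta_term k (1 / t) a c n" for n
    by (simp add: fourier_transform_gaussian[OF t k] theta_term_def)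
  have "norm (fourier_transform ?h (of_int n))
      = norm ((- \<i> / t) ^ k / sqrt t) * norm (theta_term k (1 / t) a c n)" for n
    using arg_cong[OF transform[of n], of norm] by (simp only: norm_mult norm_character mult_1_right)
  then have "(\<lambda>n::int. norm (fourier_transform ?h (of_int n))) summable_on UNIV"
    using c t k by (simp only:) (intro summable_on_cmult_right theta_term_abs_summable; simp)
  from poisson_summation[OF this a]
  have "(\<Sum>\<^sub>\<infinity>m::int. ?h (of_int m + a)) = (- \<i> / t) ^ k / sqrt t * theta k (1 / t) a c"
    by (simp only: transform theta_def infsum_cmult_right')
  moreover have "?h (of_int m + a) = character (- (a * c)) * theta_term k t (1 - c) a m" for m :: int
  proof -
    have "character (- ((of_int m + a) * c)) * character (of_int m)
        = character (- (a * c)) * character (of_int m * (1 - c))"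
      unfolding character_add[symmetric]
      by (rule arg_cong[where f = character]) (simp add: algebra_simps)
    then show ?thesis by (simp add: theta_term_def mult_ac)
  qed
  ultimately show ?thesis by (simp only: theta_def infsum_cmult_right')
qed

section \<open>Mellin transforms in the logarithmic variable\<close>

text \<open>In the variable \<open>u = ln t\<close> the inversion \<open>t \<mapsto> 1 / t\<close> is the reflection \<open>u \<mapsto> - u\<close>.\<close>

lemma absolutely_integrable_exp_substitution:
  fixes f :: "real \<Rightarrow> 'b::euclidean_space"
  assumes f: "f absolutely_integrable_on {0<..}" and d: "d > 0"
  shows "(\<lambda>u. (d * exp u) *\<^sub>R f (d * exp u)) absolutely_integrable_on UNIV"
    and "integral UNIV (\<lambda>u. (d * exp u) *\<^sub>R f (d * exp u)) = integral {0<..} f"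
proof -
  let ?g = "\<lambda>u. d * exp u"
  have "range ?g = {0<..}"
  proof (rule set_eqI)
    show "x \<in> range ?g \<longleftrightarrow> x \<in> {0<..}" for x
      using d by (auto simp: image_iff intro: exI[of _ "ln (x / d)"])
  qed
  then have "f absolutely_integrable_on range ?g \<and> integral (range ?g) f = integral {0<..} f"
    using f by simp
  moreover have "(?g has_real_derivative ?g u) (at u)" for u
    by (auto intro!: derivative_eq_intros)
  moreover have "inj ?g" using d by (simp add: inj_on_def)
  ultimately show "(\<lambda>u. ?g u *\<^sub>R f (?g u)) absolutely_integrable_on UNIV"
    "integral UNIV (\<lambda>u. ?g u *\<^sub>R f (?g u)) = integral {0<..} f"
    using has_absolute_integral_change_of_variables_real[of UNIV ?g ?g f "integral {0<..} f"] d by simp_all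
qed

lemma Gamma_log_integral:
  fixes z :: complex and d :: real
  assumes z: "Re z > 0" and d: "d > 0"
  shows "has_bochner_integral lborel (\<lambda>u. of_real (exp (- (d * exp u))) * exp (z * of_real u))
    (of_real d powr (- z) * Gamma z)"
proof -
  let ?f = "\<lambda>t. complex_of_real t powr (z - 1) / of_real (exp t)"
  let ?F = "\<lambda>u. of_real (exp (- (d * exp u))) * exp (z * of_real u)"
  have "(d * exp u) *\<^sub>R ?f (d * exp u) = of_real d powr z * ?F u" for u
  proof -
    have "of_real (d * exp u) powr z = of_real d powr z * exp (z * of_real u)"
      using d by (simp add: powr_def Ln_of_real ln_mult exp_add ring_distribs flip: of_real_mult)
    then show ?thesis
      using d by (simp add: powr_diff exp_minus scaleR_conv_of_real field_simps)
  qed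
  moreover have "integral {0<..} ?f = Gamma z"
    using Gamma_integral_complex'[OF z] by (rule integral_unique)
  ultimately have F: "(\<lambda>u. of_real d powr z * ?F u) absolutely_integrable_on UNIV"
    "integral UNIV (\<lambda>u. of_real d powr z * ?F u) = Gamma z"
    using absolutely_integrable_exp_substitution[OF absolutely_integrable_Gamma_integral'[OF z] d] by simp_all
  then have "integrable lebesgue (\<lambda>u. of_real d powr z * ?F u)"
    "(\<integral>u. of_real d powr z * ?F u \<partial>lebesgue) = Gamma z"
    using set_lebesgue_integral_eq_integral(2)[OF F(1)]
    by (simp_all add: set_integrable_def set_lebesgue_integral_def)
  then have "has_bochner_integral lborel (\<lambda>u. of_real d powr z * ?F u) (Gamma z)"
    by (simp add: has_bochner_integral_iff integrable_completion integral_completion)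
  from has_bochner_integral_mult_right[OF this, of "of_real d powr (- z)"]
  show ?thesis
    using d by (simp add: powr_minus flip: mult.assoc)
qed

lemma Gamma_log_integral_real:
  fixes r d :: real
  assumes r: "r > 0" and d: "d > 0"
  shows "has_bochner_integral lborel (\<lambda>u. exp (- (d * exp u)) * exp (r * u)) (d powr (- r) * Gamma r)"
proof -
  have "has_bochner_integral lborel (\<lambda>u. Re (of_real (exp (- (d * exp u))) * exp (of_real r * of_real u)))
     (Re (of_real d powr (- of_real r) * Gamma (of_real r)))"
    using assms by (intro has_bochner_integral_bounded_linear[OF bounded_linear_Re] Gamma_log_integral) auto
  moreover have "of_real (exp (- (d * exp u))) * exp (of_real r * of_real u)
      = complex_of_real (exp (- (d * exp u)) * exp (r * u))" for u
    by (simp flip: exp_of_real)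
  moreover have "of_real d powr (- of_real r) * Gamma (of_real r)
      = complex_of_real (d powr (- r) * Gamma r)"
    using d by (simp add: Gamma_complex_of_real powr_of_real flip: of_real_minus)
  ultimately show ?thesis by (simp only: Re_complex_of_real)
qed

lemma norm_integral_le_Gamma:
  fixes f :: "real \<Rightarrow> complex"
  assumes f: "integrable lborel f" "\<And>u. norm (f u) \<le> C * (exp (- exp u) * exp (r * u))" and r: "r > 0"
  shows "norm (\<integral>u. f u \<partial>lborel) \<le> C * Gamma r"
proof -
  have Gamma: "has_bochner_integral lborel (\<lambda>u. C * (exp (- exp u) * exp (r * u))) (C * Gamma r)"
    using has_bochner_integral_mult_right[OF Gamma_log_integral_real[OF r, of 1]] by simp
  have "norm (\<integral>u. f u \<partial>lborel) \<le> (\<integral>u. norm (f u) \<partial>lborel)" by (rule integral_norm_bound)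
  also have "\<dots> \<le> (\<integral>u. C * (exp (- exp u) * exp (r * u)) \<partial>lborel)"
    using f Gamma[THEN integrable.intros]
    by (intro Bochner_Integration.integral_mono integrable_norm) auto
  also have "\<dots> = C * Gamma r" using Gamma by (rule has_bochner_integral_integral_eq)
  finally show ?thesis .
qed

lemma set_integrable_exp_exp:
  fixes r d :: real
  assumes d: "d > 0"
  shows "set_integrable lborel {0..} (\<lambda>u. exp (- (d * exp u)) * exp (r * u))"
  unfolding set_integrable_def
proof (rule Bochner_Integration.integrable_bound)
  show "integrable lborel (\<lambda>u. exp (- (d * exp u)) * exp (max r 1 * u))"
    using Gamma_log_integral_real[of "max r 1" d] d by (simp add: has_bochner_integral_iff)
qed (auto simp: indicator_def mult_right_mono)

lemma sum_exp_series_le: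
  fixes x :: real
  assumes "x \<ge> 0"
  shows "(\<Sum>i<n. x ^ i /\<^sub>R fact i) \<le> exp x"
  unfolding sums_unique[OF exp_converges[of x]]
  using assms by (intro sum_le_suminf sums_summable[OF exp_converges[of x]]) auto

lemma laplace_transform_sums:
  fixes g :: "'a \<Rightarrow> complex" and X :: "'a \<Rightarrow> real"
  assumes [measurable]: "g \<in> borel_measurable M" "X \<in> borel_measurable M"
    and dominated: "integrable M (\<lambda>x. norm (g x) * exp (norm z * \<bar>X x\<bar>))"
  shows "(\<lambda>n. (\<integral>x. g x * (of_real (X x) ^ n /\<^sub>R fact n) \<partial>M) * z ^ n)
      sums (\<integral>x. g x * exp (z * of_real (X x)) \<partial>M)"
proof -
  define f where "f = (\<lambda>n x. g x * ((z * of_real (X x)) ^ n /\<^sub>R fact n))"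
  define w where "w = (\<lambda>x. norm (g x) * exp (norm z * \<bar>X x\<bar>))"
  have w: "integrable M w" unfolding w_def by (rule dominated)
  have partial_sum_le: "(\<Sum>i<n. norm (f i x)) \<le> w x" for n x
  proof -
    have "(\<Sum>i<n. norm (f i x)) = norm (g x) * (\<Sum>i<n. (norm z * \<bar>X x\<bar>) ^ i /\<^sub>R fact i)"
      by (simp add: f_def norm_mult norm_power sum_distrib_left mult_ac)
    also have "\<dots> \<le> w x"
      unfolding w_def by (intro mult_left_mono sum_exp_series_le) auto
    finally show ?thesis .
  qed
  have f_integrable: "integrable M (f n)" for n
  proof (rule Bochner_Integration.integrable_bound[OF w])
    show "f n \<in> borel_measurable M" unfolding f_def by measurable
    have "norm (f n x) \<le> (\<Sum>i<Suc n. norm (f i x))" for x by (simp add: sum_nonneg)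
    then have "norm (f n x) \<le> w x" for x using partial_sum_le by (rule order_trans)
    then show "AE x in M. norm (f n x) \<le> norm (w x)" by (simp add: order_trans[OF _ abs_ge_self])
  qed
  have "(\<lambda>n. \<integral>x. (\<Sum>i<n. f i x) \<partial>M) \<longlonglongrightarrow> (\<integral>x. g x * exp (z * of_real (X x)) \<partial>M)"
  proof (rule integral_dominated_convergence[OF _ _ w])
    have "(\<lambda>n. f n x) sums (g x * exp (z * of_real (X x)))" for x
      unfolding f_def by (intro sums_mult exp_converges)
    then show "AE x in M. (\<lambda>n. \<Sum>i<n. f i x) \<longlonglongrightarrow> g x * exp (z * of_real (X x))"
      by (simp add: sums_def)
    show "AE x in M. norm (\<Sum>i<n. f i x) \<le> w x" for n
      using order_trans[OF norm_sum partial_sum_le] by simp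
  qed (simp_all add: f_def)
  then have "(\<lambda>n. integral\<^sup>L M (f n)) sums (\<integral>x. g x * exp (z * of_real (X x)) \<partial>M)"
    using f_integrable by (simp add: sums_def)
  moreover have "f n = (\<lambda>x. (g x * (of_real (X x) ^ n /\<^sub>R fact n)) * z ^ n)" for n
    by (simp add: fun_eq_iff f_def power_mult_distrib scaleR_conv_of_real mult_ac)
  ultimately show ?thesis by (simp only: integral_mult_left_zero)
qed

lemma laplace_transform_entire:
  fixes g :: "'a \<Rightarrow> complex" and X :: "'a \<Rightarrow> real"
  assumes "g \<in> borel_measurable M" "X \<in> borel_measurable M"
    and "\<And>r. integrable M (\<lambda>x. norm (g x) * exp (r * \<bar>X x\<bar>))"
  shows "(\<lambda>z. \<integral>x. g x * exp (z * of_real (X x)) \<partial>M) holomorphic_on UNIV" (is "?F holomorphic_on UNIV")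
proof -
  have "?F holomorphic_on ball 0 r" for r
    by (rule power_series_holomorphic[where a = "\<lambda>n. \<integral>x. g x * (of_real (X x) ^ n /\<^sub>R fact n) \<partial>M"])
      (simp only: diff_zero laplace_transform_sums[OF assms])
  then have "?F holomorphic_on (\<Union>r. ball 0 r)"
    by (intro holomorphic_on_UN_open) auto
  also have "(\<Union>r. ball (0 :: complex) r) = UNIV"
    by (auto intro: gt_ex)
  finally show ?thesis .
qed

definition mellin_kernel :: "nat \<Rightarrow> complex \<Rightarrow> real \<Rightarrow> complex" where
  "mellin_kernel k s u = exp ((s + of_nat k) / 2 * of_real u)"

lemma norm_mellin_kernel: "norm (mellin_kernel k s u) = exp ((Re s + k) / 2 * u)"
  by (simp add: mellin_kernel_def norm_exp_eq_Re)

lemma mellin_kernel_measurable [measurable]: "mellin_kernel k s \<in> borel_measurable borel"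
  unfolding mellin_kernel_def by measurable

definition Lerch_factor :: "nat \<Rightarrow> complex \<Rightarrow> complex" where
  "Lerch_factor k s = of_real pi powr (- ((s + of_nat k) / 2)) * Gamma ((s + of_nat k) / 2)"

lemma power_mult_powr_square:
  fixes x :: real and s :: complex
  assumes x: "x \<noteq> 0"
  shows "of_real (x ^ k) * of_real (pi * x\<^sup>2) powr (- ((s + of_nat k) / 2))
    = of_real pi powr (- ((s + of_nat k) / 2)) * (of_real (sgn x ^ k) * of_real \<bar>x\<bar> powr (- s))"
proof -
  define z where "z = (s + of_nat k) / 2"
  define l where "l = complex_of_real (ln \<bar>x\<bar>)"
  have "x ^ k = sgn x ^ k * \<bar>x\<bar> ^ k" by (metis mult_sgn_abs power_mult_distrib)
  moreover have "complex_of_real (\<bar>x\<bar> ^ k) = exp (of_nat k * l)"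
    using x by (simp add: l_def exp_of_nat_mult exp_of_real)
  moreover have "complex_of_real \<bar>x\<bar> powr (- s) = exp (- s * l)"
    using x by (simp add: l_def powr_def Ln_of_real)
  moreover have "complex_of_real (pi * x\<^sup>2) powr (- z) = of_real pi powr (- z) * exp (- z * (2 * l))"
  proof -
    have "ln (pi * x\<^sup>2) = ln pi + 2 * ln \<bar>x\<bar>"
      using x ln_mult_pos[of pi "\<bar>x\<bar>\<^sup>2"] ln_realpow[of "\<bar>x\<bar>" 2] by simp
    moreover have "Ln (of_real (pi * x\<^sup>2)) = of_real (ln (pi * x\<^sup>2))"
      using x by (intro Ln_of_real) simp
    ultimately have "Ln (of_real (pi * x\<^sup>2)) = of_real (ln pi) + 2 * l"
      by (simp only: l_def of_real_add of_real_mult of_real_numeral)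
    then show ?thesis
      using x by (simp add: powr_def Ln_of_real ring_distribs flip: exp_add)
  qed
  moreover have "exp (of_nat k * l) * exp (- z * (2 * l)) = exp (- s * l)"
    unfolding exp_add[symmetric] by (rule arg_cong[where f = exp]) (simp add: z_def field_simps)
  ultimately show ?thesis by (simp add: z_def mult_ac)
qed

lemma gaussian_mellin:
  fixes x :: real
  assumes s: "Re s + k > 0" and x: "x \<noteq> 0"
  shows "has_bochner_integral lborel (\<lambda>u. of_real (gaussian k (exp u) x) * mellin_kernel k s u)
     (Lerch_factor k s * of_real (sgn x ^ k) * of_real \<bar>x\<bar> powr (- s))"
proof -
  define z where "z = (s + of_nat k) / 2"
  have "Re z > 0" using s by (simp add: z_def)
  then have "has_bochner_integral lborel
      (\<lambda>u. of_real (x ^ k) * (of_real (exp (- (pi * x\<^sup>2 * exp u))) * exp (z * of_real u)))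
      (of_real (x ^ k) * (of_real (pi * x\<^sup>2) powr (- z) * Gamma z))"
    using x by (intro has_bochner_integral_mult_right Gamma_log_integral) auto
  moreover have "of_real (x ^ k) * (of_real (exp (- (pi * x\<^sup>2 * exp u))) * exp (z * of_real u))
      = of_real (gaussian k (exp u) x) * mellin_kernel k s u" for u
    by (simp add: z_def gaussian_def mellin_kernel_def mult_ac)
  moreover have "of_real (x ^ k) * (of_real (pi * x\<^sup>2) powr (- z) * Gamma z)
      = Lerch_factor k s * of_real (sgn x ^ k) * of_real \<bar>x\<bar> powr (- s)"
    unfolding mult.assoc[symmetric] z_def power_mult_powr_square[OF x]
    by (simp add: Lerch_factor_def mult_ac)
  ultimately show ?thesis by (simp only:)
qed

definition Lerch_term :: "nat \<Rightarrow> complex \<Rightarrow> real \<Rightarrow> real \<Rightarrow> int \<Rightarrow> complex" where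
  "Lerch_term k s a c n
      = of_real (sgn (of_int n + c) ^ k) * character (of_int n * a) * of_real \<bar>of_int n + c\<bar> powr (- s)"

definition Lerch_series :: "nat \<Rightarrow> complex \<Rightarrow> real \<Rightarrow> real \<Rightarrow> complex" where
  "Lerch_series k s a c = (\<Sum>\<^sub>\<infinity>n. Lerch_term k s a c n)"

lemma theta_term_mellin:
  assumes "Re s + k > 0" "of_int n + c \<noteq> 0"
  shows "has_bochner_integral lborel (\<lambda>u. theta_term k (exp u) a c n * mellin_kernel k s u)
     (Lerch_factor k s * Lerch_term k s a c n)"
  using has_bochner_integral_mult_right[OF gaussian_mellin[OF assms], of "character (of_int n * a)"]
  by (simp add: theta_term_def Lerch_term_def mult_ac)

lemma integral_norm_theta_term_mellin:
  assumes "Re s + k > 0" "of_int n + c \<noteq> 0"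
  shows "(\<integral>u. norm (theta_term k (exp u) a c n * mellin_kernel k s u) \<partial>lborel)
    = norm (Lerch_factor k (Re s)) * \<bar>of_int n + c\<bar> powr (- Re s)"
proof -
  let ?x = "\<bar>of_int n + c\<bar>"
  have "complex_of_real (norm (theta_term k (exp u) a c n * mellin_kernel k s u))
      = of_real (gaussian k (exp u) ?x) * mellin_kernel k (Re s) u" for u
    unfolding norm_mult norm_theta_term norm_mellin_kernel gaussian_abs
    by (simp add: mellin_kernel_def exp_of_real[symmetric])
  moreover have "has_bochner_integral lborel (\<lambda>u. of_real (gaussian k (exp u) ?x) * mellin_kernel k (Re s) u)
      (Lerch_factor k (Re s) * of_real (sgn ?x ^ k) * of_real \<bar>?x\<bar> powr (- of_real (Re s)))"
    using assms by (intro gaussian_mellin) auto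
  ultimately have "complex_of_real (\<integral>u. norm (theta_term k (exp u) a c n * mellin_kernel k s u) \<partial>lborel)
      = Lerch_factor k (Re s) * of_real ?x powr (- of_real (Re s))"
    using assms(2) by (simp add: has_bochner_integral_iff flip: integral_complex_of_real)
  from arg_cong[OF this, of norm] show ?thesis
    using assms(2) by (simp add: norm_mult norm_powr_real_powr)
qed

lemma int_add_nonzero: "0 < c \<Longrightarrow> c < 1 \<Longrightarrow> real_of_int n + c \<noteq> 0"
  by (cases "n \<ge> 0") linarith+

lemma theta_mellin:
  assumes c: "0 < c" "c < 1" and k: "k \<le> 1" and s: "Re s > 1"
  shows "has_bochner_integral lborel (\<lambda>u. theta k (exp u) a c * mellin_kernel k s u)
    (Lerch_factor k s * Lerch_series k s a c)"
proof -
  define f where "f = (\<lambda>n u. theta_term k (exp u) a c n * mellin_kernel k s u)"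
  have f: "has_bochner_integral lborel (f n) (Lerch_factor k s * Lerch_term k s a c n)" for n
    unfolding f_def using s int_add_nonzero[OF c] by (intro theta_term_mellin) auto
  have f_summable: "(\<lambda>n. norm (f n u)) summable_on UNIV" for u
    unfolding f_def norm_mult using c k by (intro summable_on_cmult_left theta_term_abs_summable) auto
  have "(\<integral>u. norm (f n u) \<partial>lborel) = norm (Lerch_factor k (Re s)) * \<bar>of_int n + c\<bar> powr (- Re s)" for n
    unfolding f_def using s int_add_nonzero[OF c] by (intro integral_norm_theta_term_mellin) auto
  then have "(\<lambda>n. \<integral>u. norm (f n u) \<partial>lborel) summable_on UNIV"
    using s c by (simp only:) (intro summable_on_cmult_right summable_on_int_add_powr; simp)
  note termwise = integral_infsum[OF lborel.sigma_finite_measure_axioms _ f_summable this]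
  have theta: "(\<Sum>\<^sub>\<infinity>n. f n u) = theta k (exp u) a c * mellin_kernel k s u" for u
    by (simp only: f_def theta_def infsum_cmult_left')
  have "(\<integral>u. theta k (exp u) a c * mellin_kernel k s u \<partial>lborel) = (\<Sum>\<^sub>\<infinity>n. integral\<^sup>L lborel (f n))"
    using termwise(2) f unfolding theta
    by (intro infsumI[symmetric]) (auto simp: has_bochner_integral_iff)
  also have "\<dots> = Lerch_factor k s * Lerch_series k s a c"
    using f by (simp add: has_bochner_integral_iff Lerch_series_def infsum_cmult_right')
  finally show ?thesis
    using termwise(1) f unfolding theta by (simp add: has_bochner_integral_iff)
qed

lemma theta_measurable:
  fixes \<upsilon> \<alpha> \<gamma> :: "'a \<Rightarrow> real"
  assumes [measurable]: "\<upsilon> \<in> borel_measurable M" "\<alpha> \<in> borel_measurable M" "\<gamma> \<in> borel_measurable M"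
    and k: "k \<le> 1"
  shows "(\<lambda>x. indicator {0..1} (\<gamma> x) *\<^sub>R theta k (exp (\<upsilon> x)) (\<alpha> x) (\<gamma> x)) \<in> borel_measurable M"
proof -
  have "(\<lambda>x. \<Sum>\<^sub>\<infinity>n. indicator {0..1} (\<gamma> x) *\<^sub>R theta_term k (exp (\<upsilon> x)) (\<alpha> x) (\<gamma> x) n)
      \<in> borel_measurable M"
  proof (rule borel_measurable_infsum)
    show "(\<lambda>x. indicator {0..1} (\<gamma> x) *\<^sub>R theta_term k (exp (\<upsilon> x)) (\<alpha> x) (\<gamma> x) n)
        \<in> borel_measurable M" for n
      unfolding theta_term_def gaussian_def by measurable
    show "(\<lambda>n. norm (indicator {0..1} (\<gamma> x) *\<^sub>R theta_term k (exp (\<upsilon> x)) (\<alpha> x) (\<gamma> x) n))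
        summable_on UNIV" for x
      using theta_term_abs_summable[of "\<gamma> x" "exp (\<upsilon> x)" k "\<alpha> x"] k by (cases "\<gamma> x \<in> {0..1}") auto
  qed
  then show ?thesis by (simp only: theta_def infsum_scaleR_right)
qed

lemma theta_exp_measurable:
  assumes "0 \<le> c" "c \<le> 1" "k \<le> 1"
  shows "(\<lambda>u. theta k (exp u) a c) \<in> borel_measurable borel"
  using theta_measurable[of "\<lambda>u. u" borel "\<lambda>_. a" "\<lambda>_. c" k] assms by simp

definition theta_bound :: "real \<Rightarrow> real \<Rightarrow> real" where
  "theta_bound c u = exp (- (pi * c\<^sup>2 * exp u)) + exp (- (pi * (1 - c)\<^sup>2 * exp u))
      + theta_tail_const * exp (- (1 * exp u))"

lemma theta_bound_nonneg: "0 \<le> theta_bound c u"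
  unfolding theta_bound_def using theta_tail_const_nonneg by simp

lemma set_integrable_theta_bound:
  assumes "0 < c" "c < 1"
  shows "set_integrable lborel {0..} (\<lambda>u. theta_bound c u * exp (r * u))"
  using assms unfolding theta_bound_def ring_distribs mult.assoc[of theta_tail_const]
  by (intro set_integral_add set_integrable_mult_right set_integrable_exp_exp) auto

lemma norm_theta_le_bound:
  assumes c: "0 < c" "c < 1" and u: "u \<ge> 0" and k: "k \<le> 1"
  shows "norm (theta k (exp u) a c) \<le> theta_bound c u"
proof -
  let ?t = "exp u"
  have near: "norm (theta_term k ?t a c n) \<le> exp (- (pi * (of_int n + c)\<^sup>2 * ?t))"
    if "\<bar>of_int n + c\<bar> \<le> 1" for n
    using that mult_right_mono[OF power_le_one[of "\<bar>of_int n + c\<bar>" k],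
        of "exp (- (pi * (of_int n + c)\<^sup>2 * ?t))"]
    by (simp add: norm_theta_term gaussian_def abs_mult power_abs mult_ac)
  have "norm (theta k ?t a c)
      \<le> norm (theta_near k ?t a c) + norm (theta k ?t a c - theta_near k ?t a c)"
    by (rule norm_triangle_sub)
  also have "\<dots> \<le> (norm (theta_term k ?t a c 0) + norm (theta_term k ?t a c (-1)))
      + theta_tail_const * exp (- ?t)"
    using c u k unfolding theta_near_def[of k ?t a c, symmetric]
    by (intro add_mono norm_theta_minus_near_le) (auto simp: theta_near_def norm_triangle_ineq)
  also have "\<dots> \<le> theta_bound c u"
    using near[of 0] near[of "-1"] c by (simp add: theta_bound_def power2_commute[of c 1])
  finally show ?thesis .
qed

definition half_mellin :: "nat \<Rightarrow> complex \<Rightarrow> real \<Rightarrow> real \<Rightarrow> complex" where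
  "half_mellin k s a c = (LBINT u:{0..}. theta k (exp u) a c * mellin_kernel k s u)"

lemma norm_theta_mellin_kernel_le:
  assumes "0 < c" "c < 1" "u \<ge> 0" "k \<le> 1"
  shows "norm (theta k (exp u) a c * mellin_kernel k s u) \<le> theta_bound c u * exp ((Re s + k) / 2 * u)"
  using norm_theta_le_bound[OF assms] by (simp add: norm_mult norm_mellin_kernel)

lemma half_mellin_integrable:
  assumes "0 < c" "c < 1" "k \<le> 1"
  shows "set_integrable lborel {0..} (\<lambda>u. theta k (exp u) a c * mellin_kernel k s u)"
proof (rule set_integrable_bound[OF set_integrable_theta_bound[OF assms(1,2), of "(Re s + k) / 2"]])
  have [measurable]: "(\<lambda>u. theta k (exp u) a c) \<in> borel_measurable borel"
    by (rule theta_exp_measurable) (use assms in auto)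
  show "set_borel_measurable lborel {0..} (\<lambda>u. theta k (exp u) a c * mellin_kernel k s u)"
    unfolding set_borel_measurable_def by measurable
qed (use norm_theta_mellin_kernel_le assms theta_bound_nonneg in \<open>auto simp: abs_mult\<close>)

lemma norm_half_mellin_le:
  assumes "0 < c" "c < 1" "k \<le> 1"
  shows "norm (half_mellin k s a c) \<le> (LBINT u:{0..}. theta_bound c u * exp ((Re s + k) / 2 * u))"
proof -
  have "norm (half_mellin k s a c) \<le> (LBINT u:{0..}. norm (theta k (exp u) a c * mellin_kernel k s u))"
    unfolding half_mellin_def by (rule set_integral_norm_bound[OF half_mellin_integrable[OF assms]])
  also have "\<dots> \<le> (LBINT u:{0..}. theta_bound c u * exp ((Re s + k) / 2 * u))"
    using assms norm_theta_mellin_kernel_le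
    by (intro set_integral_mono set_integrable_norm half_mellin_integrable set_integrable_theta_bound) auto
  finally show ?thesis .
qed

lemma half_mellin_entire:
  assumes "0 < c" "c < 1" "k \<le> 1"
  shows "(\<lambda>s. half_mellin k s a c) holomorphic_on UNIV"
proof -
  define g where "g = (\<lambda>u. indicator {0..} u *\<^sub>R (theta k (exp u) a c * mellin_kernel k 0 u))"
  have kernel: "mellin_kernel k s u = mellin_kernel k 0 u * exp (s * of_real (u / 2))" for s u
    by (simp add: mellin_kernel_def field_simps flip: exp_add)
  have [measurable]: "(\<lambda>u. theta k (exp u) a c) \<in> borel_measurable borel"
    by (rule theta_exp_measurable) (use assms in auto)
  have "(\<lambda>s. \<integral>u. g u * exp (s * of_real (u / 2)) \<partial>lborel) holomorphic_on UNIV"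
  proof (rule laplace_transform_entire)
    fix r :: real
    have "integrable lborel (\<lambda>u. norm (indicator {0..} u *\<^sub>R
        (theta k (exp u) a c * mellin_kernel k (of_real r) u)))"
      using half_mellin_integrable[OF assms] unfolding set_integrable_def by (rule integrable_norm)
    moreover have "norm (indicator {0..} u *\<^sub>R (theta k (exp u) a c * mellin_kernel k (of_real r) u))
        = norm (g u) * exp (r * \<bar>u / 2\<bar>)" for u
      unfolding kernel[of "of_real r"] by (auto simp: g_def indicator_def norm_mult norm_exp_eq_Re)
    ultimately show "integrable lborel (\<lambda>u. norm (g u) * exp (r * \<bar>u / 2\<bar>))" by (simp only:)
  qed (simp_all add: g_def)
  moreover have "g u * exp (s * of_real (u / 2))
      = indicator {0..} u *\<^sub>R (theta k (exp u) a c * mellin_kernel k s u)" for s u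
    unfolding kernel[of s] by (simp add: g_def mult.assoc)
  ultimately show ?thesis by (simp only: half_mellin_def set_lebesgue_integral_def)
qed

section \<open>The completed functions and their functional equation\<close>

definition completed_Lerch :: "nat \<Rightarrow> complex \<Rightarrow> real \<Rightarrow> real \<Rightarrow> complex" where
  "completed_Lerch k s a c
      = half_mellin k s a c + \<i> ^ k * character (- (a * c)) * half_mellin k (1 - s) (1 - c) a"

lemma half_mellin_reflect:
  "half_mellin k s (1 - a) (1 - c) = (- 1) ^ k * character a * half_mellin k s a c"
  unfolding half_mellin_def theta_reflect mult.assoc by (simp only: set_integral_mult_right)

theorem completed_Lerch_functional_equation:
  "completed_Lerch k s a c = \<i> ^ k * character (- (a * c)) * completed_Lerch k (1 - s) (1 - c) a"
proof -
  have sign: "\<i> ^ k * \<i> ^ k * (- 1) ^ k = (1::complex)"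
    by (simp flip: power_mult_distrib)
  have phase: "character (- (a * c)) * (character (- ((1 - c) * a)) * character a) = 1"
    unfolding character_add[symmetric] by (simp add: algebra_simps)
  have "\<i> ^ k * character (- (a * c)) * completed_Lerch k (1 - s) (1 - c) a
     = \<i> ^ k * character (- (a * c)) * half_mellin k (1 - s) (1 - c) a
     + (\<i> ^ k * \<i> ^ k * (- 1) ^ k) * (character (- (a * c)) * (character (- ((1 - c) * a)) * character a))
         * half_mellin k s a c"
    unfolding completed_Lerch_def by (simp add: half_mellin_reflect ring_distribs mult_ac)
  then show ?thesis unfolding sign phase by (simp add: completed_Lerch_def)
qed

lemma completed_Lerch_entire:
  assumes "0 < a" "a < 1" "0 < c" "c < 1" "k \<le> 1"
  shows "(\<lambda>s. completed_Lerch k s a c) holomorphic_on UNIV"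
  unfolding completed_Lerch_def
  by (intro holomorphic_intros half_mellin_entire[OF assms(3-5)]
      holomorphic_on_compose_gen[OF _ half_mellin_entire[OF assms(1,2,5)], unfolded o_def]) auto

lemma theta_inversion:
  assumes a: "0 < a" "a < 1" and c: "0 < c" "c < 1" and k: "k \<le> 1"
  shows "theta k (exp (- u)) a c * mellin_kernel k s (- u)
    = \<i> ^ k * character (- (a * c)) * (theta k (exp u) (1 - c) a * mellin_kernel k (1 - s) u)"
proof -
  define q where "q = character (- (a * c)) * theta k (exp u) (1 - c) a"
  have "(\<i> * exp u) ^ k * (- \<i> / exp u) ^ k = (1::complex)"
    by (simp flip: power_mult_distrib)
  moreover have "sqrt (exp u) = exp (u / 2)"
    by (rule real_sqrt_unique) (simp_all add: power2_eq_square flip: exp_add)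
  moreover have "q = (- \<i> / exp u) ^ k / sqrt (exp u) * theta k (exp (- u)) a c"
    unfolding q_def using theta_transformation[OF a _ _ exp_gt_zero[of u] k, of c] c
    by (simp add: exp_minus divide_inverse)
  ultimately have "theta k (exp (- u)) a c = (\<i> * exp u) ^ k * exp (u / 2) * q" by simp
  then have "theta k (exp (- u)) a c * mellin_kernel k s (- u)
      = \<i> ^ k * q * (exp (of_nat k * of_real u) * exp (of_real (u / 2))
          * exp ((s + of_nat k) / 2 * of_real (- u)))"
    by (simp only: mellin_kernel_def power_mult_distrib exp_of_nat_mult exp_of_real of_real_mult mult_ac)
  also have "exp (of_nat k * of_real u) * exp (of_real (u / 2))
      * exp ((s + of_nat k) / 2 * of_real (- u)) = mellin_kernel k (1 - s) u"
    unfolding exp_add[symmetric] mellin_kernel_def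
    by (rule arg_cong[where f = exp]) (simp add: field_simps)
  finally show ?thesis by (simp add: q_def mult_ac)
qed

lemma integral_lborel_split_at_0:
  fixes F :: "real \<Rightarrow> 'b::{banach, second_countable_topology}"
  assumes "integrable lborel F"
  shows "(\<integral>u. F u \<partial>lborel) = (LBINT u:{0..}. F u) + (LBINT u:{..<0}. F u)"
proof -
  have "(LBINT u:{0..} \<union> {..<0}. F u) = (LBINT u:{0..}. F u) + (LBINT u:{..<0}. F u)"
    by (rule set_integral_Un) (auto simp: set_integrable_def intro!: integrable_mult_indicator assms)
  moreover have "{0..} \<union> {..<0} = (UNIV :: real set)" by auto
  ultimately show ?thesis by (simp add: set_lebesgue_integral_def)
qed

lemma set_integral_lborel_reflect:
  fixes F :: "real \<Rightarrow> complex"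
  assumes "integrable lborel F"
  shows "(LBINT u:{..<0}. F u) = (LBINT u:{0..}. F (- u))"
proof -
  have [measurable]: "F \<in> borel_measurable borel" using assms by (simp add: borel_measurable_integrable)
  have "(LBINT u:{..<0}. F u) = (\<integral>u. indicator {..<0} (0 + - 1 * u) *\<^sub>R F (0 + - 1 * u) \<partial>lborel)"
    unfolding set_lebesgue_integral_def by (subst lborel_integral_real_affine[of "-1" _ 0]) auto
  also have "\<dots> = (LBINT u:{0..}. F (- u))"
    unfolding set_lebesgue_integral_def
    by (intro integral_cong_AE) (auto intro!: AE_I[where N = "{0}"] simp: indicator_def)
  finally show ?thesis .
qed

lemma completed_Lerch_eq_series:
  assumes a: "0 < a" "a < 1" and c: "0 < c" "c < 1" and k: "k \<le> 1" and s: "Re s > 1"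
  shows "completed_Lerch k s a c = Lerch_factor k s * Lerch_series k s a c"
proof -
  let ?F = "\<lambda>u. theta k (exp u) a c * mellin_kernel k s u"
  have F: "integrable lborel ?F" "(\<integral>u. ?F u \<partial>lborel) = Lerch_factor k s * Lerch_series k s a c"
    using theta_mellin[OF c k s, of a] by (simp_all add: has_bochner_integral_iff)
  have "(LBINT u:{..<0}. ?F u) = (LBINT u:{0..}. theta k (exp (- u)) a c * mellin_kernel k s (- u))"
    by (rule set_integral_lborel_reflect[OF F(1)])
  also have "\<dots> = \<i> ^ k * character (- (a * c)) * half_mellin k (1 - s) (1 - c) a"
    unfolding theta_inversion[OF a c k] half_mellin_def by (rule set_integral_mult_right)
  finally show ?thesis
    using integral_lborel_split_at_0[OF F(1)] by (simp add: completed_Lerch_def half_mellin_def F(2))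
qed

text \<open>The reciprocal of \<open>Lerch_factor\<close>, but entire: at the poles of Gamma it vanishes.\<close>

definition Lerch_cofactor :: "nat \<Rightarrow> complex \<Rightarrow> complex" where
  "Lerch_cofactor k s = of_real pi powr ((s + of_nat k) / 2) * rGamma ((s + of_nat k) / 2)"

lemma Lerch_cofactor_mult_factor:
  assumes "Re s + k > 0"
  shows "Lerch_cofactor k s * Lerch_factor k s = 1"
proof -
  define z where "z = (s + of_nat k) / 2"
  have "Re z > 0" using assms by (simp add: z_def)
  then have "z \<notin> \<int>\<^sub>\<le>\<^sub>0" by (auto elim!: nonpos_Ints_cases)
  then have "rGamma z * Gamma z = 1"
    by (simp add: rGamma_inverse_Gamma Gamma_eq_zero_iff)
  then show ?thesis
    unfolding Lerch_cofactor_def Lerch_factor_def z_def[symmetric] by (simp add: powr_minus field_simps)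
qed

lemma Lerch_factor_nonzero: "Re s > 0 \<Longrightarrow> Lerch_factor k s \<noteq> 0"
  using Lerch_cofactor_mult_factor[of s k] by auto

lemma entire_continuation_Lerch_series:
  assumes "0 < a" "a < 1" "0 < c" "c < 1" "k \<le> 1"
  shows "entire_continuation (\<lambda>s. Lerch_series k s a c)
      = (\<lambda>s. Lerch_cofactor k s * completed_Lerch k s a c)"
proof (rule entire_continuation_eqI)
  show "(\<lambda>s. Lerch_cofactor k s * completed_Lerch k s a c) holomorphic_on UNIV"
    unfolding Lerch_cofactor_def
    by (intro holomorphic_intros completed_Lerch_entire assms
        holomorphic_on_compose_gen[OF _ holomorphic_rGamma, unfolded o_def]) auto
  fix s :: complex assume "Re s > 1"
  then show "Lerch_cofactor k s * completed_Lerch k s a c = Lerch_series k s a c"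
    using completed_Lerch_eq_series[OF assms] Lerch_cofactor_mult_factor[of s k]
    by (simp flip: mult.assoc)
qed

lemma Lerch_plus_eq:
  assumes "0 < a" "a < 1" "0 < c" "c < 1"
  shows "Lerch_plus s a c = Lerch_cofactor 0 s * completed_Lerch 0 s a c"
proof -
  have "Lerch_plus_series z a c = Lerch_series 0 z a c" for z
    by (simp add: Lerch_plus_series_def Lerch_series_def Lerch_term_def character_eq_exp mult.assoc)
  then show ?thesis by (simp add: Lerch_plus_def entire_continuation_Lerch_series[OF assms])
qed

lemma Lerch_minus_eq:
  assumes "0 < a" "a < 1" "0 < c" "c < 1"
  shows "Lerch_minus s a c = Lerch_cofactor 1 s * completed_Lerch 1 s a c"
proof -
  have "Lerch_minus_series z a c = Lerch_series 1 z a c" for z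
    by (simp add: Lerch_minus_series_def Lerch_series_def Lerch_term_def character_eq_exp mult.assoc)
  then show ?thesis by (simp add: Lerch_minus_def entire_continuation_Lerch_series[OF assms])
qed

section \<open>Boundary behaviour\<close>

lemma theta_term_half_mellin_asymp:
  assumes s: "Re s > 0" and c: "of_int n + c \<noteq> 0" "\<bar>of_int n + c\<bar> \<le> 1"
  shows "norm ((LBINT u:{0..}. theta_term k (exp u) a c n * mellin_kernel k s u)
      - Lerch_factor k s * Lerch_term k s a c n)
    \<le> exp 1 * Gamma ((Re s + k) / 2)"
proof -
  define F where "F = (\<lambda>u. theta_term k (exp u) a c n * mellin_kernel k s u)"
  have "has_bochner_integral lborel F (Lerch_factor k s * Lerch_term k s a c n)"
    unfolding F_def using s c by (intro theta_term_mellin) auto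
  then have F: "integrable lborel F" "(\<integral>u. F u \<partial>lborel) = Lerch_factor k s * Lerch_term k s a c n"
    by (simp_all add: has_bochner_integral_iff)
  have "norm (\<integral>u. indicator {..<0} u *\<^sub>R F u \<partial>lborel) \<le> exp 1 * Gamma ((Re s + k) / 2)"
  proof (rule norm_integral_le_Gamma)
    show "integrable lborel (\<lambda>u. indicator {..<0} u *\<^sub>R F u)"
      by (intro integrable_mult_indicator F) simp
    show "norm (indicator {..<0} u *\<^sub>R F u) \<le> exp 1 * (exp (- exp u) * exp ((Re s + k) / 2 * u))" for u
    proof (cases "u < 0")
      case True
      have "norm (F u) \<le> 1 * exp ((Re s + k) / 2 * u)"
        unfolding F_def norm_mult norm_theta_term norm_mellin_kernel
        using c by (intro mult_right_mono abs_gaussian_le_1) auto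
      also have "\<dots> \<le> exp (1 - exp u) * exp ((Re s + k) / 2 * u)"
        using True by (intro mult_right_mono) auto
      also have "\<dots> = exp 1 * (exp (- exp u) * exp ((Re s + k) / 2 * u))"
        unfolding mult.assoc[symmetric] exp_add[symmetric] by simp
      finally show ?thesis using True by simp
    qed simp
  qed (use s in simp)
  moreover have "(LBINT u:{0..}. F u) - Lerch_factor k s * Lerch_term k s a c n
      = - (\<integral>u. indicator {..<0} u *\<^sub>R F u \<partial>lborel)"
    using integral_lborel_split_at_0[OF F(1)] by (simp add: F(2) set_lebesgue_integral_def)
  ultimately show ?thesis by (simp add: F_def)
qed

text \<open>The two terms of the series that are unbounded as \<open>c\<close> approaches \<open>0\<close> or \<open>1\<close>.\<close>

definition Lerch_near :: "nat \<Rightarrow> complex \<Rightarrow> real \<Rightarrow> real \<Rightarrow> complex" where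
  "Lerch_near k s a c = Lerch_term k s a c 0 + Lerch_term k s a c (-1)"

lemma Lerch_near_eq:
  assumes "0 < c" "c < 1"
  shows "Lerch_near k s a c
      = of_real c powr (- s) + (- 1) ^ k * character (- a) * of_real (1 - c) powr (- s)"
  using assms by (simp add: Lerch_near_def Lerch_term_def abs_if sgn_if)

lemma theta_term_half_mellin_integrable:
  assumes "Re s + k > 0" "of_int n + c \<noteq> 0"
  shows "set_integrable lborel {0..} (\<lambda>u. theta_term k (exp u) a c n * mellin_kernel k s u)"
  using theta_term_mellin[OF assms, of a] unfolding set_integrable_def
  by (intro integrable_mult_indicator) (auto simp: has_bochner_integral_iff)

lemma theta_minus_near_half_mellin_le:
  assumes s: "Re s > 0" and k: "k \<le> 1" and c: "0 < c" "c < 1"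
  shows "norm (LBINT u:{0..}. (theta k (exp u) a c - theta_near k (exp u) a c) * mellin_kernel k s u)
    \<le> theta_tail_const * Gamma ((Re s + k) / 2)"
  unfolding set_lebesgue_integral_def
proof (rule norm_integral_le_Gamma)
  let ?R = "\<lambda>u. (theta k (exp u) a c - theta_near k (exp u) a c) * mellin_kernel k s u"
  have "set_integrable lborel {0..} ?R"
    unfolding theta_near_def left_diff_distrib ring_distribs
    using s k c int_add_nonzero[OF c]
    by (intro set_integral_diff set_integral_add
        half_mellin_integrable theta_term_half_mellin_integrable) auto
  then show "integrable lborel (\<lambda>u. indicator {0..} u *\<^sub>R ?R u)"
    by (simp only: set_integrable_def)
  show "norm (indicator {0..} u *\<^sub>R ?R u)
      \<le> theta_tail_const * (exp (- exp u) * exp ((Re s + k) / 2 * u))" for u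
  proof (cases "u \<ge> 0")
    case True
    then have "norm (?R u) \<le> theta_tail_const * exp (- exp u) * exp ((Re s + k) / 2 * u)"
      unfolding norm_mult norm_mellin_kernel
      using c k by (intro mult_right_mono norm_theta_minus_near_le) auto
    then show ?thesis using True by (simp add: mult.assoc)
  qed (simp add: theta_tail_const_nonneg)
qed (use s in simp)

lemma half_mellin_asymp:
  assumes s: "Re s > 0" and k: "k \<le> 1" and c: "0 < c" "c < 1"
  shows "norm (half_mellin k s a c - Lerch_factor k s * Lerch_near k s a c)
    \<le> (theta_tail_const + 2 * exp 1) * Gamma ((Re s + k) / 2)"
proof -
  let ?\<Gamma> = "Gamma ((Re s + k) / 2)"
  define G where "G = (\<lambda>n u. theta_term k (exp u) a c n * mellin_kernel k s u)"
  define A where "A = (\<lambda>n. LBINT u:{0..}. G n u)"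
  define R where "R = (LBINT u:{0..}. (theta k (exp u) a c - theta_near k (exp u) a c) * mellin_kernel k s u)"
  let ?err = "\<lambda>n. A n - Lerch_factor k s * Lerch_term k s a c n"
  have G: "set_integrable lborel {0..} (G n)" for n
    unfolding G_def using s int_add_nonzero[OF c] by (intro theta_term_half_mellin_integrable) auto
  have "R = half_mellin k s a c - (A 0 + A (-1))"
    unfolding half_mellin_def A_def set_integral_add(2)[OF G G, symmetric]
      set_integral_diff(2)[OF half_mellin_integrable[OF c k] set_integral_add(1)[OF G G], symmetric]
    by (simp add: R_def G_def theta_near_def ring_distribs)
  then have "half_mellin k s a c - Lerch_factor k s * Lerch_near k s a c = R + (?err 0 + ?err (-1))"
    by (simp add: Lerch_near_def ring_distribs)
  moreover have "norm (?err n) \<le> exp 1 * ?\<Gamma>" if "n \<in> {0, -1}" for n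
    unfolding A_def G_def using that c by (intro theta_term_half_mellin_asymp s) auto
  moreover have "norm R \<le> theta_tail_const * ?\<Gamma>"
    unfolding R_def by (rule theta_minus_near_half_mellin_le[OF s k c])
  ultimately have "norm (half_mellin k s a c - Lerch_factor k s * Lerch_near k s a c)
      \<le> theta_tail_const * ?\<Gamma> + (exp 1 * ?\<Gamma> + exp 1 * ?\<Gamma>)"
    by (simp only:) (intro order.trans[OF norm_triangle_ineq] add_mono; simp)
  then show ?thesis by (simp add: ring_distribs)
qed

lemma completed_Lerch_asymp:
  assumes s: "Re s > 0" and k: "k \<le> 1" and a: "0 < a" "a < 1"
  obtains C where "\<And>c. 0 < c \<Longrightarrow> c < 1 \<Longrightarrow>
      norm (completed_Lerch k s a c - Lerch_factor k s * Lerch_near k s a c) \<le> C"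
proof
  fix c :: real assume c: "0 < c" "c < 1"
  let ?dual = "\<i> ^ k * character (- (a * c)) * half_mellin k (1 - s) (1 - c) a"
  have "completed_Lerch k s a c - Lerch_factor k s * Lerch_near k s a c
      = (half_mellin k s a c - Lerch_factor k s * Lerch_near k s a c) + ?dual"
    by (simp add: completed_Lerch_def)
  also have "norm \<dots> \<le> (theta_tail_const + 2 * exp 1) * Gamma ((Re s + k) / 2)
      + (LBINT u:{0..}. theta_bound a u * exp ((Re (1 - s) + k) / 2 * u))"
    using half_mellin_asymp[OF s k c, of a] norm_half_mellin_le[OF a k, of "1 - s" "1 - c"]
    by (intro order.trans[OF norm_triangle_ineq] add_mono) (simp_all add: norm_mult norm_power)
  finally show "norm (completed_Lerch k s a c - Lerch_factor k s * Lerch_near k s a c)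
    \<le> (theta_tail_const + 2 * exp 1) * Gamma ((Re s + k) / 2)
      + (LBINT u:{0..}. theta_bound a u * exp ((Re (1 - s) + k) / 2 * u))" .
qed

section \<open>Power singularities at the endpoints of an interval\<close>

lemma add_powr_le:
  fixes x y p :: real
  assumes "0 \<le> x" "0 \<le> y" "0 \<le> p"
  shows "(x + y) powr p \<le> 2 powr p * (x powr p + y powr p)"
proof -
  have "(x + y) powr p \<le> (2 * max x y) powr p"
    using assms by (intro powr_mono2) auto
  also have "\<dots> = 2 powr p * max x y powr p" using assms by (simp add: powr_mult)
  also have "\<dots> \<le> 2 powr p * (x powr p + y powr p)"
    by (intro mult_left_mono) (auto simp: max_def)
  finally show ?thesis .
qed

lemma not_set_integrable_powr_at_0:
  fixes b q :: real
  assumes b: "0 < b" and q: "q \<ge> 1"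
  shows "\<not> set_integrable lborel {0<..<b} (\<lambda>x. x powr (- q))"
proof
  assume power_integrable: "set_integrable lborel {0<..<b} (\<lambda>x. x powr (- q))"
  define I where "I = (LBINT x:{0<..<b}. x powr (- q))"
  define m where "m = min b 1 / 2"
  define e where "e = m * exp (- (\<bar>I\<bar> + 1))"
  have m: "0 < m" "m < b" "m < 1" using b by (auto simp: m_def)
  have e: "0 < e" "e \<le> m" using m by (simp_all add: e_def mult_le_cancel_left1)
  have log: "has_bochner_integral lborel (\<lambda>x. (1 / x) * indicator {e..m} x) (ln m - ln e)"
    using e by (intro has_bochner_integral_FTC_Icc_real)
        (auto intro!: derivative_eq_intros continuous_intros)
  have "ln m - ln e \<le> I"
    unfolding I_def has_bochner_integral_integral_eq[OF log, symmetric] set_lebesgue_integral_def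
  proof (rule Bochner_Integration.integral_mono)
    fix x :: real
    show "1 / x * indicator {e..m} x \<le> indicator {0<..<b} x *\<^sub>R x powr (- q)"
    proof (cases "x \<in> {e..m}")
      case True
      then have x: "0 < x" "x < b" "x \<le> 1" using e m by auto
      have "x powr (- 1) \<le> x powr (- q)" using x q by (intro powr_mono') auto
      then show ?thesis using True x by (simp add: powr_minus_divide)
    qed simp
  qed (use log power_integrable in \<open>auto simp: has_bochner_integral_iff set_integrable_def\<close>)
  moreover have "ln e = ln m - (\<bar>I\<bar> + 1)"
    unfolding e_def using m by (simp add: ln_mult)
  ultimately show False by linarith
qed

lemma not_set_integrable_norm_powr_of_asymp:
  fixes f :: "real \<Rightarrow> complex"
  assumes b: "0 < b" and \<kappa>: "\<kappa> \<noteq> 0" and p: "p > 0" "Re s * p \<ge> 1"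
    and B: "\<And>x. 0 < x \<Longrightarrow> x < b \<Longrightarrow> norm (f x - \<kappa> * of_real x powr (- s)) \<le> B"
  shows "\<not> set_integrable lborel {0<..<b} (\<lambda>x. norm (f x) powr p)"
proof
  assume integrable_f: "set_integrable lborel {0<..<b} (\<lambda>x. norm (f x) powr p)"
  have B0: "B \<ge> 0" using order.trans[OF norm_ge_zero B[of "b/2"]] b by simp
  define g where "g = (\<lambda>x. (2 powr p / norm \<kappa> powr p) * (norm (f x) powr p + B powr p))"
  have powr_le_g: "x powr (- (Re s * p)) \<le> g x" if x: "0 < x" "x < b" for x
  proof -
    have "norm \<kappa> * x powr (- Re s) = norm (\<kappa> * of_real x powr (- s))"
      using x by (simp add: norm_mult norm_powr_real_powr)
    also have "\<dots> \<le> norm (f x) + B"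
      using norm_triangle_sub[of "\<kappa> * of_real x powr (- s)" "f x"] B[OF x]
      by (simp add: norm_minus_commute)
    finally have "(norm \<kappa> * x powr (- Re s)) powr p \<le> (norm (f x) + B) powr p"
      using p by (intro powr_mono2) auto
    also have "\<dots> \<le> 2 powr p * (norm (f x) powr p + B powr p)"
      using B0 p by (intro add_powr_le) auto
    also have "(norm \<kappa> * x powr (- Re s)) powr p = norm \<kappa> powr p * x powr (- (Re s * p))"
      by (simp add: powr_mult powr_powr)
    finally show ?thesis using \<kappa> by (simp add: g_def field_simps)
  qed
  have "set_integrable lborel {0<..<b} (\<lambda>x. B powr p)"
    using b by (simp add: set_integrable_def)
  then have "set_integrable lborel {0<..<b} g"
    unfolding g_def by (intro set_integrable_mult_right set_integral_add integrable_f)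
  then have "set_integrable lborel {0<..<b} (\<lambda>x. x powr (- (Re s * p)))"
    by (rule set_integrable_bound)
        (auto simp: set_borel_measurable_def intro!: order_trans[OF powr_le_g abs_ge_self])
  then show False using not_set_integrable_powr_at_0[OF b p(2)] by blast
qed

lemma not_set_integrable_norm_powr_of_asymp_endpoints:
  fixes f :: "real \<Rightarrow> complex"
  assumes \<kappa>: "\<kappa> \<noteq> 0" and p: "p > 0" "Re s * p \<ge> 1"
    and C: "\<And>x. 0 < x \<Longrightarrow> x < 1 \<Longrightarrow>
        norm (f x - (\<kappa> * of_real x powr (- s) + \<kappa>' * of_real (1 - x) powr (- s))) \<le> C"
  shows "\<not> set_integrable lborel {0<..<1} (\<lambda>x. norm (f x) powr p)"
proof -
  have s: "Re s > 0" using p zero_less_mult_pos2[of "Re s" p] by linarith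
  have "norm (f x - \<kappa> * of_real x powr (- s))
      \<le> C + norm \<kappa>' * 2 powr Re s" if x: "0 < x" "x < 1 / 2" for x
  proof -
    let ?far = "\<kappa>' * of_real (1 - x) powr (- s)"
    have "(1 - x) powr (- Re s) \<le> (1 / 2) powr (- Re s)" using x s by (intro powr_mono2') auto
    also have "\<dots> = 2 powr Re s" by (simp add: powr_minus powr_divide)
    finally have "norm ?far \<le> norm \<kappa>' * 2 powr Re s"
      using x by (auto simp: norm_mult norm_powr_real_powr simp del: of_real_diff intro!: mult_left_mono)
    then show ?thesis
      using C[of x] x norm_triangle_ineq[of "f x - (\<kappa> * of_real x powr (- s) + ?far)" ?far] by simp
  qed
  then have "\<not> set_integrable lborel {0<..<1/2} (\<lambda>x. norm (f x) powr p)"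
    by (intro not_set_integrable_norm_powr_of_asymp[OF _ \<kappa> p]) auto
  then show ?thesis
    by (rule contrapos_nn) (erule set_integrable_subset; auto)
qed

lemma set_integrable_unit_interval_reflect:
  fixes f :: "real \<Rightarrow> 'b::{banach, second_countable_topology}"
  assumes "set_integrable lborel {0<..<1} f"
  shows "set_integrable lborel {0<..<1} (\<lambda>x. f (1 - x))"
proof -
  have "integrable lborel (\<lambda>x. indicator {0<..<1} (1 + - 1 * x) *\<^sub>R f (1 + - 1 * x))"
    using assms unfolding set_integrable_def by (rule lborel_integrable_real_affine) simp
  also have "(\<lambda>x. indicator {0<..<1} (1 + - 1 * x) *\<^sub>R f (1 + - 1 * x))
      = (\<lambda>x. indicator {0<..<1} x *\<^sub>R f (1 - x))"
    by (auto simp: fun_eq_iff indicator_def)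
  finally show ?thesis by (simp only: set_integrable_def)
qed

lemma set_integrable_norm_powr_imp_coefficients_0:
  fixes f :: "real \<Rightarrow> complex"
  assumes integrable_f: "set_integrable lborel {0<..<1} (\<lambda>x. norm (f x) powr p)"
    and p: "p > 0" "Re s * p \<ge> 1"
    and C: "\<And>x. 0 < x \<Longrightarrow> x < 1 \<Longrightarrow>
        norm (f x - (\<kappa> * of_real x powr (- s) + \<kappa>' * of_real (1 - x) powr (- s))) \<le> C"
  shows "\<kappa> = 0" "\<kappa>' = 0"
proof -
  show "\<kappa> = 0"
    using not_set_integrable_norm_powr_of_asymp_endpoints[OF _ p C] integrable_f by blast
  have "norm (f (1 - x) - (\<kappa>' * of_real x powr (- s) + \<kappa> * of_real (1 - x) powr (- s)))
      \<le> C" if "0 < x" "x < 1" for x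
    using C[of "1 - x"] that by (simp add: add.commute)
  then show "\<kappa>' = 0"
    using not_set_integrable_norm_powr_of_asymp_endpoints[OF _ p, of \<kappa>' "\<lambda>x. f (1 - x)" \<kappa> C]
      set_integrable_unit_interval_reflect[OF integrable_f] by blast
qed

section \<open>Combinations of the completed functions\<close>

definition completed_combination :: "complex \<Rightarrow> complex \<Rightarrow> complex \<Rightarrow> real \<Rightarrow> real \<Rightarrow> complex" where
  "completed_combination s \<alpha> \<beta> a c = \<alpha> * completed_Lerch 0 s a c + \<beta> * completed_Lerch 1 s a c"

lemma norm_completed_combination_reflect:
  "norm (completed_combination s \<alpha> \<beta> a c) = norm (completed_combination (1 - s) \<alpha> (\<i> * \<beta>) (1 - c) a)"
proof -
  have "completed_combination s \<alpha> \<beta> a c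
     = character (- (a * c)) * completed_combination (1 - s) \<alpha> (\<i> * \<beta>) (1 - c) a"
    unfolding completed_combination_def
    by (subst (1 2) completed_Lerch_functional_equation) (simp add: algebra_simps)
  then show ?thesis by (simp add: norm_mult)
qed

lemma completed_combination_asymp:
  assumes s: "Re s > 0" and a: "0 < a" "a < 1"
  obtains C where "\<And>c. 0 < c \<Longrightarrow> c < 1 \<Longrightarrow> norm (completed_combination s \<alpha> \<beta> a c
    - ((\<alpha> * Lerch_factor 0 s + \<beta> * Lerch_factor 1 s) * of_real c powr (- s)
      + (\<alpha> * Lerch_factor 0 s - \<beta> * Lerch_factor 1 s) * character (- a) * of_real (1 - c) powr (- s))) \<le> C"
proof -
  let ?err = "\<lambda>k c. completed_Lerch k s a c - Lerch_factor k s * Lerch_near k s a c"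
  obtain C0 where C0: "\<And>c. 0 < c \<Longrightarrow> c < 1 \<Longrightarrow> norm (?err 0 c) \<le> C0"
    using completed_Lerch_asymp[OF s _ a, of 0] by auto
  obtain C1 where C1: "\<And>c. 0 < c \<Longrightarrow> c < 1 \<Longrightarrow> norm (?err 1 c) \<le> C1"
    using completed_Lerch_asymp[OF s _ a, of 1] by auto
  show ?thesis
  proof (rule that)
    fix c :: real assume c: "0 < c" "c < 1"
    have "completed_combination s \<alpha> \<beta> a c
    - ((\<alpha> * Lerch_factor 0 s + \<beta> * Lerch_factor 1 s) * of_real c powr (- s)
      + (\<alpha> * Lerch_factor 0 s - \<beta> * Lerch_factor 1 s) * character (- a) * of_real (1 - c) powr (- s))
      = \<alpha> * ?err 0 c + \<beta> * ?err 1 c"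
      by (simp add: completed_combination_def Lerch_near_eq[OF c] algebra_simps)
    also have "norm \<dots> \<le> norm \<alpha> * C0 + norm \<beta> * C1"
      using C0[OF c] C1[OF c]
      by (intro order.trans[OF norm_triangle_ineq] add_mono) (auto simp: norm_mult intro!: mult_left_mono)
    finally show "norm (completed_combination s \<alpha> \<beta> a c
    - ((\<alpha> * Lerch_factor 0 s + \<beta> * Lerch_factor 1 s) * of_real c powr (- s)
      + (\<alpha> * Lerch_factor 0 s - \<beta> * Lerch_factor 1 s) * character (- a) * of_real (1 - c) powr (- s)))
      \<le> norm \<alpha> * C0 + norm \<beta> * C1" .
  qed
qed

lemma completed_combination_slice_not_integrable:
  assumes p: "p > 0" "Re s * p \<ge> 1" and a: "0 < a" "a < 1" and nonzero: "\<alpha> \<noteq> 0 \<or> \<beta> \<noteq> 0"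
  shows "\<not> set_integrable lborel {0<..<1} (\<lambda>c. norm (completed_combination s \<alpha> \<beta> a c) powr p)"
proof
  assume slice_integrable: "set_integrable lborel {0<..<1} (\<lambda>c. norm (completed_combination s \<alpha> \<beta> a c) powr p)"
  have s: "Re s > 0" using p zero_less_mult_pos2[of "Re s" p] by linarith
  let ?x = "\<alpha> * Lerch_factor 0 s" and ?y = "\<beta> * Lerch_factor 1 s"
  obtain C where "\<And>c. 0 < c \<Longrightarrow> c < 1 \<Longrightarrow> norm (completed_combination s \<alpha> \<beta> a c
    - ((?x + ?y) * of_real c powr (- s) + (?x - ?y) * character (- a) * of_real (1 - c) powr (- s))) \<le> C"
    using completed_combination_asymp[OF s a] by blast
  from set_integrable_norm_powr_imp_coefficients_0[OF slice_integrable p this]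
  have "?x + ?y = 0" "?x - ?y = 0" by simp_all
  then have "2 * ?x = 0" "?y = ?x" by (auto simp: algebra_simps)
  then show False using nonzero Lerch_factor_nonzero[OF s] by simp
qed

definition endpoint_weight :: "real \<Rightarrow> real \<Rightarrow> real" where
  "endpoint_weight r x = x powr (- r) + (1 - x) powr (- r)"

lemma endpoint_weight_nonneg: "0 \<le> endpoint_weight r x"
  by (simp add: endpoint_weight_def)

lemma endpoint_weight_measurable [measurable]: "endpoint_weight r \<in> borel_measurable borel"
  unfolding endpoint_weight_def by measurable

lemma half_mellin_bound:
  assumes s: "Re s > 0" and k: "k \<le> 1"
  obtains C where "C \<ge> 0"
    "\<And>a c. 0 < c \<Longrightarrow> c < 1 \<Longrightarrow> norm (half_mellin k s a c) \<le> C * endpoint_weight (Re s) c"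
proof
  define K where "K = (theta_tail_const + 2 * exp 1) * Gamma ((Re s + k) / 2)"
  have K: "K \<ge> 0" using s theta_tail_const_nonneg by (simp add: K_def Gamma_real_pos less_imp_le)
  then show "0 \<le> K + norm (Lerch_factor k s)" by simp
  fix a c :: real assume c: "0 < c" "c < 1"
  have near: "norm (Lerch_near k s a c) \<le> endpoint_weight (Re s) c"
    unfolding Lerch_near_eq[OF c] endpoint_weight_def using c
    by (intro order.trans[OF norm_triangle_ineq] add_mono)
      (simp_all add: norm_mult norm_power norm_powr_real_powr del: of_real_diff)
  have "1 powr (- Re s) \<le> c powr (- Re s)" using c s by (intro powr_mono2') auto
  then have weight: "1 \<le> endpoint_weight (Re s) c" by (simp add: endpoint_weight_def add_increasing2)
  have "norm (half_mellin k s a c)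
      \<le> norm (Lerch_factor k s * Lerch_near k s a c)
          + norm (half_mellin k s a c - Lerch_factor k s * Lerch_near k s a c)"
    by (rule norm_triangle_sub)
  also have "\<dots> \<le> norm (Lerch_factor k s) * endpoint_weight (Re s) c + K * endpoint_weight (Re s) c"
  proof (rule add_mono)
    show "norm (Lerch_factor k s * Lerch_near k s a c)
        \<le> norm (Lerch_factor k s) * endpoint_weight (Re s) c"
      unfolding norm_mult using near by (intro mult_left_mono) auto
    have "norm (half_mellin k s a c - Lerch_factor k s * Lerch_near k s a c) \<le> K * 1"
      using half_mellin_asymp[OF s k c] by (simp add: K_def)
    also have "\<dots> \<le> K * endpoint_weight (Re s) c" using weight K by (intro mult_left_mono)
    finally show "norm (half_mellin k s a c - Lerch_factor k s * Lerch_near k s a c)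
        \<le> K * endpoint_weight (Re s) c" .
  qed
  finally show "norm (half_mellin k s a c) \<le> (K + norm (Lerch_factor k s)) * endpoint_weight (Re s) c"
    by (simp add: ring_distribs)
qed

lemma completed_Lerch_bound:
  assumes s: "0 < Re s" "Re s < 1" and k: "k \<le> 1"
  obtains C where "C \<ge> 0" "\<And>a c. 0 < a \<Longrightarrow> a < 1 \<Longrightarrow> 0 < c \<Longrightarrow> c < 1 \<Longrightarrow>
    norm (completed_Lerch k s a c) \<le> C * (endpoint_weight (1 - Re s) a + endpoint_weight (Re s) c)"
proof -
  have s': "0 < Re (1 - s)" "Re (1 - s) = 1 - Re s" using s(2) by simp_all
  obtain C1 where C1: "C1 \<ge> 0"
    "\<And>a c. 0 < c \<Longrightarrow> c < 1 \<Longrightarrow> norm (half_mellin k s a c) \<le> C1 * endpoint_weight (Re s) c"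
    using half_mellin_bound[OF s(1) k] by metis
  obtain C2 where C2: "C2 \<ge> 0"
    "\<And>a c. 0 < c \<Longrightarrow> c < 1 \<Longrightarrow> norm (half_mellin k (1 - s) a c) \<le> C2 * endpoint_weight (Re (1 - s)) c"
    using half_mellin_bound[OF s'(1) k] by metis
  show ?thesis
  proof
    show "0 \<le> C1 + C2" using C1(1) C2(1) by simp
    fix a c :: real assume a: "0 < a" "a < 1" and c: "0 < c" "c < 1"
    let ?A = "endpoint_weight (1 - Re s) a" and ?C = "endpoint_weight (Re s) c"
    have "norm (completed_Lerch k s a c)
        \<le> norm (half_mellin k s a c) + norm (half_mellin k (1 - s) (1 - c) a)"
      unfolding completed_Lerch_def
      by (rule order.trans[OF norm_triangle_ineq]) (simp add: norm_mult norm_power)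
    also have "\<dots> \<le> C1 * ?C + C2 * ?A"
      using C1(2)[OF c] C2(2)[OF a] unfolding s'(2) by (intro add_mono)
    also have "\<dots> \<le> (C1 + C2) * (?A + ?C)"
      using C1(1) C2(1) endpoint_weight_nonneg by (simp add: ring_distribs)
    finally show "norm (completed_Lerch k s a c) \<le> (C1 + C2) * (?A + ?C)" .
  qed
qed

lemma completed_combination_bound:
  assumes s: "0 < Re s" "Re s < 1"
  obtains C where "C \<ge> 0" "\<And>a c. 0 < a \<Longrightarrow> a < 1 \<Longrightarrow> 0 < c \<Longrightarrow> c < 1 \<Longrightarrow>
    norm (completed_combination s \<alpha> \<beta> a c)
      \<le> C * (endpoint_weight (1 - Re s) a + endpoint_weight (Re s) c)"
proof -
  let ?W = "\<lambda>a c. endpoint_weight (1 - Re s) a + endpoint_weight (Re s) c"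
  obtain C0 where C0: "C0 \<ge> 0" "\<And>a c. 0 < a \<Longrightarrow> a < 1 \<Longrightarrow> 0 < c \<Longrightarrow> c < 1 \<Longrightarrow>
      norm (completed_Lerch 0 s a c) \<le> C0 * ?W a c"
    using completed_Lerch_bound[OF s, of 0] by auto
  obtain C1 where C1: "C1 \<ge> 0" "\<And>a c. 0 < a \<Longrightarrow> a < 1 \<Longrightarrow> 0 < c \<Longrightarrow> c < 1 \<Longrightarrow>
      norm (completed_Lerch 1 s a c) \<le> C1 * ?W a c"
    using completed_Lerch_bound[OF s, of 1] by auto
  show ?thesis
  proof
    show "0 \<le> norm \<alpha> * C0 + norm \<beta> * C1" using C0(1) C1(1) by simp
    fix a c :: real assume ac: "0 < a" "a < 1" "0 < c" "c < 1"
    have "norm (completed_combination s \<alpha> \<beta> a c) \<le> norm \<alpha> * (C0 * ?W a c) + norm \<beta> * (C1 * ?W a c)"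
      unfolding completed_combination_def using C0(2)[OF ac] C1(2)[OF ac]
      by (intro order.trans[OF norm_triangle_ineq] add_mono) (auto simp: norm_mult intro!: mult_left_mono)
    then show "norm (completed_combination s \<alpha> \<beta> a c) \<le> (norm \<alpha> * C0 + norm \<beta> * C1) * ?W a c"
      by (simp add: ring_distribs mult.assoc)
  qed
qed

section \<open>Integrability on the unit square\<close>

lemma half_mellin_measurable:
  fixes \<alpha> \<gamma> :: "'a \<Rightarrow> real"
  assumes [measurable]: "\<alpha> \<in> borel_measurable M" "\<gamma> \<in> borel_measurable M" and k: "k \<le> 1"
  shows "(\<lambda>x. indicator {0..1} (\<gamma> x) *\<^sub>R half_mellin k s (\<alpha> x) (\<gamma> x)) \<in> borel_measurable M"
proof -
  define F where "F = (\<lambda>x u. indicator {0..1} (\<gamma> x) *\<^sub>R theta k (exp u) (\<alpha> x) (\<gamma> x))"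
  have "(\<lambda>(x, u). F x u) \<in> borel_measurable (M \<Otimes>\<^sub>M lborel)"
    unfolding F_def case_prod_beta' by (rule theta_measurable) (use k in auto)
  then have "(\<lambda>x. LBINT u:{0..}. F x u * mellin_kernel k s u) \<in> borel_measurable M"
    unfolding set_lebesgue_integral_def by measurable
  moreover have "(LBINT u:{0..}. F x u * mellin_kernel k s u)
      = indicator {0..1} (\<gamma> x) *\<^sub>R half_mellin k s (\<alpha> x) (\<gamma> x)" for x
    by (cases "\<gamma> x \<in> {0..1}") (simp_all add: F_def half_mellin_def)
  ultimately show ?thesis by simp
qed

lemma on_open_square_eq_indicator:
  "on_open_square g x = indicator ({0<..<1} \<times> {0<..<1}) x *\<^sub>R g (fst x) (snd x)"
  by (auto simp: on_open_square_def indicator_def split: prod.splits)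

lemma on_open_square_completed_Lerch_measurable:
  assumes k: "k \<le> 1"
  shows "on_open_square (completed_Lerch k s) \<in> borel_measurable borel"
proof -
  have [measurable]: "(\<lambda>x. indicator {0..1} (snd x) *\<^sub>R half_mellin k s (fst x) (snd x))
      \<in> borel_measurable (borel \<Otimes>\<^sub>M borel)"
    "(\<lambda>x. indicator {0..1} (fst x) *\<^sub>R half_mellin k (1 - s) (1 - snd x) (fst x))
        \<in> borel_measurable (borel \<Otimes>\<^sub>M borel)"
    by (rule half_mellin_measurable; use k in simp)+
  define g where "g = (\<lambda>x. indicator ({0<..<1} \<times> {0<..<1}) x *\<^sub>R
      (indicator {0..1} (snd x) *\<^sub>R half_mellin k s (fst x) (snd x) +
       \<i> ^ k * character (- (fst x * snd x))
           * (indicator {0..1} (fst x) *\<^sub>R half_mellin k (1 - s) (1 - snd x) (fst x))))"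
  have "g \<in> borel_measurable (borel \<Otimes>\<^sub>M borel)"
    unfolding g_def by (intro borel_measurable_scaleR borel_measurable_indicator pair_measureI; measurable)
  moreover have "g = on_open_square (completed_Lerch k s)"
    by (auto simp: g_def fun_eq_iff on_open_square_eq_indicator completed_Lerch_def indicator_def)
  ultimately show ?thesis by (simp add: borel_prod)
qed

definition Lerch_combination :: "complex \<Rightarrow> complex \<Rightarrow> complex \<Rightarrow> real \<times> real \<Rightarrow> complex" where
  "Lerch_combination s \<alpha> \<beta> = on_open_square (completed_combination s \<alpha> \<beta>)"

lemma Lerch_combination_measurable [measurable]: "Lerch_combination s \<alpha> \<beta> \<in> borel_measurable borel"
proof -
  note on_open_square_completed_Lerch_measurable[of 0 s, measurable]
      on_open_square_completed_Lerch_measurable[of 1 s, measurable]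
  have "Lerch_combination s \<alpha> \<beta>
      = (\<lambda>x. \<alpha> * on_open_square (completed_Lerch 0 s) x + \<beta> * on_open_square (completed_Lerch 1 s) x)"
    by (auto simp: fun_eq_iff Lerch_combination_def completed_combination_def on_open_square_def)
  then show ?thesis by (simp only:) measurable
qed

lemma lmeasurable_unit_square: "{0..1::real} \<times> {0..1::real} \<in> lmeasurable"
  using lmeasurable_cbox[of "(0, 0)" "(1::real, 1::real)"] by (simp add: cbox_Pair_eq)

lemma in_Lp_on_open_square_iff:
  assumes [measurable]: "on_open_square g \<in> borel_measurable borel"
  shows "in_Lp unit_square (ereal p) (on_open_square g)
    \<longleftrightarrow> set_integrable lborel ({0<..<1} \<times> {0<..<1}) (\<lambda>(a, c). norm (g a c) powr p)"
proof -
  let ?f = "\<lambda>x. norm (on_open_square g x) powr p"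
  have "on_open_square g \<in> borel_measurable lebesgue" by (rule measurable_completion) simp
  then have "on_open_square g \<in> borel_measurable unit_square"
    unfolding unit_square_def by (rule measurable_restrict_space1)
  then have "in_Lp unit_square (ereal p) (on_open_square g) \<longleftrightarrow> integrable unit_square ?f"
    by (simp add: in_Lp_def)
  also have "\<dots> \<longleftrightarrow> integrable lebesgue (\<lambda>x. indicator ({0..1} \<times> {0..1}) x *\<^sub>R ?f x)"
    unfolding unit_square_def
    by (intro integrable_restrict_space) (use fmeasurableD[OF lmeasurable_unit_square] in simp)
  also have "(\<lambda>x. indicator ({0..1} \<times> {0..1}) x *\<^sub>R ?f x) = ?f"
    by (auto simp: fun_eq_iff on_open_square_def indicator_def)
  also have "integrable lebesgue ?f \<longleftrightarrow> integrable lborel ?f"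
    by (rule integrable_completion) simp
  also have "?f = (\<lambda>x. indicator ({0<..<1} \<times> {0<..<1}) x *\<^sub>R (case x of (a, c) \<Rightarrow> norm (g a c) powr p))"
    by (auto simp: fun_eq_iff on_open_square_def indicator_def)
  finally show ?thesis by (simp only: set_integrable_def)
qed

lemma Lerch_combination_in_Lp_iff:
  "in_Lp unit_square (ereal p) (Lerch_combination s \<alpha> \<beta>)
    \<longleftrightarrow> set_integrable lborel ({0<..<1} \<times> {0<..<1}) (\<lambda>(a, c). norm (completed_combination s \<alpha> \<beta> a c) powr p)"
  using in_Lp_on_open_square_iff[of "completed_combination s \<alpha> \<beta>" p] Lerch_combination_measurable[of s \<alpha> \<beta>]
  by (simp add: Lerch_combination_def)

lemma AE_imp_ex_in_set:
  assumes "AE x in M. P x" "A \<in> sets M" "emeasure M A \<noteq> 0"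
  obtains x where "x \<in> A" "P x"
proof -
  have "\<exists>x\<in>A. P x"
  proof (rule ccontr)
    assume "\<not> (\<exists>x\<in>A. P x)"
    with assms(1) have "AE x in M. x \<notin> A" by (auto elim!: eventually_mono)
    then show False using AE_iff_null_sets[OF assms(2)] assms(3) by auto
  qed
  then show ?thesis using that by blast
qed

lemma set_integrable_slices:
  fixes F :: "real \<Rightarrow> real \<Rightarrow> 'b::{banach, second_countable_topology}"
  assumes F: "set_integrable lborel (A \<times> B) (\<lambda>(x, y). F x y)"
    and A: "A \<in> sets lborel" "emeasure lborel A \<noteq> 0" and B: "B \<in> sets lborel" "emeasure lborel B \<noteq> 0"
  obtains x y where "x \<in> A" "set_integrable lborel B (F x)" "y \<in> B" "set_integrable lborel A (\<lambda>x. F x y)"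
proof -
  have integrable_rectangle: "integrable (lborel \<Otimes>\<^sub>M lborel) (\<lambda>(x, y). indicator A x *\<^sub>R indicator B y *\<^sub>R F x y)"
    using F by (simp add: set_integrable_def lborel_prod indicator_times case_prod_beta')
  obtain x where x: "x \<in> A" "integrable lborel (\<lambda>y. indicator A x *\<^sub>R indicator B y *\<^sub>R F x y)"
    by (rule AE_imp_ex_in_set[OF lborel_pair.AE_integrable_fst[OF integrable_rectangle] A])
  obtain y where y: "y \<in> B" "integrable lborel (\<lambda>x. indicator A x *\<^sub>R indicator B y *\<^sub>R F x y)"
    by (rule AE_imp_ex_in_set[OF lborel_pair.AE_integrable_snd[OF integrable_rectangle] B])
  show ?thesis
    using x y by (intro that[of x y]) (simp_all add: set_integrable_def)
qed

lemma set_integrable_lborel_times: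
  fixes f g :: "real \<Rightarrow> real"
  assumes f: "set_integrable lborel A f" and g: "set_integrable lborel B g"
  shows "set_integrable lborel (A \<times> B) (\<lambda>(x, y). f x * g y)"
proof -
  let ?f = "\<lambda>x. indicator A x *\<^sub>R f x" and ?g = "\<lambda>y. indicator B y *\<^sub>R g y"
  have integrable_factors: "integrable lborel ?f" "integrable lborel ?g"
    using assms by (simp_all only: set_integrable_def)
  note [measurable] = integrable_factors[THEN borel_measurable_integrable]
  have "integrable (lborel \<Otimes>\<^sub>M lborel) (\<lambda>z. ?f (fst z) * ?g (snd z))"
  proof (rule lborel_pair.Fubini_integrable)
    show "integrable lborel (\<lambda>x. \<integral>y. norm (?f (fst (x, y)) * ?g (snd (x, y))) \<partial>lborel)"
      using integrable_norm[OF integrable_factors(1)]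
      by (simp only: norm_mult fst_conv snd_conv) (simp del: real_scaleR_def)
    show "AE x in lborel. integrable lborel (\<lambda>y. ?f (fst (x, y)) * ?g (snd (x, y)))"
      using integrable_factors(2) by (simp only: fst_conv snd_conv) (intro AE_I2 integrable_mult_right)
  qed measurable
  moreover have "(\<lambda>z. ?f (fst z) * ?g (snd z))
      = (\<lambda>z. indicator (A \<times> B) z *\<^sub>R (case z of (x, y) \<Rightarrow> f x * g y))"
    by (auto simp: fun_eq_iff indicator_def)
  ultimately show ?thesis by (simp only: set_integrable_def lborel_prod)
qed

proposition Lerch_combination_not_in_Lp:
  assumes p: "p \<ge> 1" "1 / p \<le> Re s \<or> Re s \<le> 1 - 1 / p" and nonzero: "\<alpha> \<noteq> 0 \<or> \<beta> \<noteq> 0"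
  shows "\<not> in_Lp unit_square (ereal p) (Lerch_combination s \<alpha> \<beta>)"
proof
  assume "in_Lp unit_square (ereal p) (Lerch_combination s \<alpha> \<beta>)"
  then obtain a c where a: "a \<in> {0<..<1}" and c: "c \<in> {0<..<1}"
    and a_slice: "set_integrable lborel {0<..<1} (\<lambda>c. norm (completed_combination s \<alpha> \<beta> a c) powr p)"
    and c_slice: "set_integrable lborel {0<..<1} (\<lambda>a. norm (completed_combination s \<alpha> \<beta> a c) powr p)"
    unfolding Lerch_combination_in_Lp_iff by (rule set_integrable_slices) auto
  from p(2) show False
  proof
    assume "1 / p \<le> Re s"
    then have "Re s * p \<ge> 1" using p(1) by (simp add: field_simps)
    then show False
      using completed_combination_slice_not_integrable[of p s a \<alpha> \<beta>] a a_slice p(1) nonzero by simp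
  next
    assume "Re s \<le> 1 - 1 / p"
    then have "Re (1 - s) * p \<ge> 1" using p(1) by (simp add: field_simps)
    then show False
      using completed_combination_slice_not_integrable[of p "1 - s" "1 - c" \<alpha> "\<i> * \<beta>"] c c_slice p(1) nonzero
      by (simp add: norm_completed_combination_reflect[of s])
  qed
qed

lemma set_integrable_endpoint_weight_powr:
  assumes p: "p \<ge> 0" "r * p < 1"
  shows "set_integrable lborel {0<..<1} (\<lambda>x. endpoint_weight r x powr p)"
proof -
  have "(\<lambda>x. x powr (- (r * p))) absolutely_integrable_on {0..1}"
    using p by (intro nonnegative_absolutely_integrable_1 integrable_on_powr_from_0) auto
  then have "set_integrable lborel {0..1} (\<lambda>x. x powr (- (r * p)))"
    unfolding set_integrable_def by (subst (asm) integrable_completion) auto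
  then have at_0: "set_integrable lborel {0<..<1} (\<lambda>x. x powr (- (r * p)))"
    by (rule set_integrable_subset) auto
  then have at_1: "set_integrable lborel {0<..<1} (\<lambda>x. (1 - x) powr (- (r * p)))"
    by (rule set_integrable_unit_interval_reflect)
  have "set_integrable lborel {0<..<1} (\<lambda>x. 2 powr p * (x powr (- (r * p)) + (1 - x) powr (- (r * p))))"
    by (intro set_integrable_mult_right set_integral_add at_0 at_1)
  then show ?thesis
  proof (rule set_integrable_bound)
    have "endpoint_weight r x powr p \<le> 2 powr p * (x powr (- (r * p)) + (1 - x) powr (- (r * p)))" for x
      using add_powr_le[of "x powr (- r)" "(1 - x) powr (- r)" p] p(1)
      by (simp add: endpoint_weight_def powr_powr)
    then show "AE x in lborel. x \<in> {0<..<1} \<longrightarrow>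
        norm (endpoint_weight r x powr p) \<le> norm (2 powr p * (x powr (- (r * p)) + (1 - x) powr (- (r * p))))"
      by (simp add: order_trans[OF _ abs_ge_self])
  qed (simp add: set_borel_measurable_def)
qed

lemma set_integrable_sum_on_unit_square:
  fixes f g :: "real \<Rightarrow> real"
  assumes "set_integrable lborel {0<..<1} f" "set_integrable lborel {0<..<1} g"
  shows "set_integrable lborel ({0<..<1} \<times> {0<..<1}) (\<lambda>(x, y). f x + g y)"
proof -
  have integrable_1: "set_integrable lborel {0<..<1::real} (\<lambda>x. 1 :: real)"
    by (simp add: set_integrable_def)
  have "set_integrable lborel ({0<..<1} \<times> {0<..<1})
      (\<lambda>z. (case z of (x, y) \<Rightarrow> f x * 1) + (case z of (x, y) \<Rightarrow> 1 * g y))"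
    by (intro set_integral_add set_integrable_lborel_times assms integrable_1)
  then show ?thesis by (simp add: case_prod_beta')
qed

proposition Lerch_combination_in_Lp:
  assumes p: "p \<ge> 1" and s: "1 - 1 / p < Re s" "Re s < 1 / p"
  shows "in_Lp unit_square (ereal p) (Lerch_combination s \<alpha> \<beta>)"
proof -
  let ?I = "{0<..<1} :: real set"
  let ?A = "\<lambda>a. endpoint_weight (1 - Re s) a" and ?C = "\<lambda>c. endpoint_weight (Re s) c"
  let ?f = "\<lambda>(a, c). norm (completed_combination s \<alpha> \<beta> a c) powr p"
  have "1 / p \<le> 1" using p by simp
  then have "0 < Re s" "Re s < 1" using s by linarith+
  then obtain K where K: "K \<ge> 0" "\<And>a c. 0 < a \<Longrightarrow> a < 1 \<Longrightarrow> 0 < c \<Longrightarrow> c < 1 \<Longrightarrow>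
    norm (completed_combination s \<alpha> \<beta> a c) \<le> K * (?A a + ?C c)"
    using completed_combination_bound by metis
  have "(1 - Re s) * p < 1" "Re s * p < 1" using s p by (simp_all add: field_simps)
  then have "set_integrable lborel (?I \<times> ?I)
      (\<lambda>x. K powr p * (2 powr p * (case x of (a, c) \<Rightarrow> ?A a powr p + ?C c powr p)))"
    using p by (intro set_integrable_mult_right set_integrable_sum_on_unit_square
        set_integrable_endpoint_weight_powr) auto
  then have "set_integrable lborel (?I \<times> ?I) ?f"
  proof (rule set_integrable_bound)
    have "?f (a, c) \<le> K powr p * (2 powr p * (?A a powr p + ?C c powr p))" if "a \<in> ?I" "c \<in> ?I" for a c
    proof -
      have "?f (a, c) \<le> (K * (?A a + ?C c)) powr p"
        using K(2) p that by (auto intro!: powr_mono2)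
      also have "\<dots> = K powr p * (?A a + ?C c) powr p"
        using K(1) endpoint_weight_nonneg by (simp add: powr_mult)
      also have "\<dots> \<le> K powr p * (2 powr p * (?A a powr p + ?C c powr p))"
        using p endpoint_weight_nonneg by (intro mult_left_mono add_powr_le) auto
      finally show ?thesis .
    qed
    then show "AE x in lborel. x \<in> ?I \<times> ?I \<longrightarrow>
        norm (?f x) \<le> norm (K powr p * (2 powr p * (case x of (a, c) \<Rightarrow> ?A a powr p + ?C c powr p)))"
      by (auto intro!: AE_I2 order_trans[OF _ abs_ge_self])
    have "(\<lambda>x. indicator (?I \<times> ?I) x *\<^sub>R ?f x) = (\<lambda>x. norm (Lerch_combination s \<alpha> \<beta> x) powr p)"
      by (auto simp: fun_eq_iff Lerch_combination_def on_open_square_def indicator_def)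
    then show "set_borel_measurable lborel (?I \<times> ?I) ?f"
      by (simp only: set_borel_measurable_def) simp
  qed
  then show ?thesis unfolding Lerch_combination_in_Lp_iff .
qed

lemma in_Lp_infinity_imp_in_Lp:
  assumes "finite_measure M" "in_Lp M \<infinity> f" "p \<ge> 0"
  shows "in_Lp M (ereal p) f"
proof -
  interpret finite_measure M by fact
  obtain C where [measurable]: "f \<in> borel_measurable M" and C: "AE x in M. norm (f x) \<le> C"
    using assms(2) by (auto simp: in_Lp_def)
  have "integrable M (\<lambda>x. norm (f x) powr p)"
  proof (rule integrable_const_bound)
    show "AE x in M. norm (norm (f x) powr p) \<le> C powr p"
      using C by eventually_elim (simp add: powr_mono2 assms(3))
  qed measurable
  then show ?thesis by (simp add: in_Lp_def)
qed

lemma finite_measure_unit_square: "finite_measure unit_square"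
  unfolding unit_square_def by (rule finite_measure_lebesgue_on[OF lmeasurable_unit_square])

section \<open>The Lerch space\<close>

lemma on_open_square_Lerch_plus:
  "on_open_square (Lerch_plus s) = Lerch_combination s (Lerch_cofactor 0 s) 0"
  by (auto simp: fun_eq_iff on_open_square_def Lerch_combination_def
      completed_combination_def Lerch_plus_eq)

lemma on_open_square_Lerch_minus:
  "on_open_square (Lerch_minus s) = Lerch_combination s 0 (Lerch_cofactor 1 s)"
  by (auto simp: fun_eq_iff on_open_square_def Lerch_combination_def
      completed_combination_def Lerch_minus_eq)

lemma on_open_square_Lerch_plus_dual:
  "on_open_square (\<lambda>a c. exp (- (2 * pi * \<i> * a * c)) * Lerch_plus (1 - s) (1 - c) a)
     = Lerch_combination s (Lerch_cofactor 0 (1 - s)) 0"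
proof -
  have "exp (- (2 * pi * \<i> * a * c)) * completed_Lerch 0 (1 - s) (1 - c) a
      = completed_Lerch 0 s a c" for a c
    using completed_Lerch_functional_equation[of 0 s a c] by (simp add: character_eq_exp mult.assoc)
  then show ?thesis
    by (auto simp: fun_eq_iff on_open_square_def Lerch_combination_def
        completed_combination_def Lerch_plus_eq mult.left_commute)
qed

lemma on_open_square_Lerch_minus_dual:
  "on_open_square (\<lambda>a c. exp (- (2 * pi * \<i> * a * c)) * Lerch_minus (1 - s) (1 - c) a)
     = Lerch_combination s 0 (- \<i> * Lerch_cofactor 1 (1 - s))"
proof -
  have "exp (- (2 * pi * \<i> * a * c)) * completed_Lerch 1 (1 - s) (1 - c) a
      = - \<i> * completed_Lerch 1 s a c" for a c
    by (subst completed_Lerch_functional_equation[of 1 s a c]) (simp add: character_eq_exp flip: mult.assoc)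
  then show ?thesis
    by (auto simp: fun_eq_iff on_open_square_def Lerch_combination_def
        completed_combination_def Lerch_minus_eq mult.left_commute)
qed

lemma subspace_Lerch_combinations:
  "module.subspace fun_scale {Lerch_combination s \<alpha> \<beta> | \<alpha> \<beta>. True}"
proof -
  interpret vector_space fun_scale by (rule vector_space_fun_scale)
  note combination_defs = on_open_square_def Lerch_combination_def completed_combination_def fun_scale_def
  have zero: "0 = Lerch_combination s 0 0"
    by (auto simp: fun_eq_iff combination_defs)
  have add: "Lerch_combination s \<alpha> \<beta> + Lerch_combination s \<alpha>' \<beta>'
      = Lerch_combination s (\<alpha> + \<alpha>') (\<beta> + \<beta>')" for \<alpha> \<beta> \<alpha>' \<beta>'
    by (auto simp: fun_eq_iff combination_defs algebra_simps)
  have scale: "fun_scale r (Lerch_combination s \<alpha> \<beta>) = Lerch_combination s (r * \<alpha>) (r * \<beta>)" for r \<alpha> \<beta>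
    by (auto simp: fun_eq_iff combination_defs algebra_simps)
  show ?thesis
    by (rule subspaceI) (auto simp: zero add scale, blast+)
qed

lemma Lerch_space_subset: "Lerch_space s \<subseteq> {Lerch_combination s \<alpha> \<beta> | \<alpha> \<beta>. True}"
proof -
  interpret vector_space fun_scale by (rule vector_space_fun_scale)
  show ?thesis
    unfolding Lerch_space_def on_open_square_Lerch_plus on_open_square_Lerch_minus
      on_open_square_Lerch_plus_dual on_open_square_Lerch_minus_dual
    by (intro span_minimal subspace_Lerch_combinations) auto
qed

lemma Lerch_space_elem_cases:
  assumes "f \<in> Lerch_space s"
  obtains \<alpha> \<beta> where "f = Lerch_combination s \<alpha> \<beta>" "f \<noteq> 0 \<Longrightarrow> \<alpha> \<noteq> 0 \<or> \<beta> \<noteq> 0"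
proof -
  obtain \<alpha> \<beta> where f: "f = Lerch_combination s \<alpha> \<beta>"
    using Lerch_space_subset assms by blast
  moreover have "Lerch_combination s 0 0 = 0"
    by (auto simp: fun_eq_iff Lerch_combination_def on_open_square_def completed_combination_def)
  ultimately show ?thesis using that by blast
qed

lemma Lerch_combination_in_Lerch_space:
  obtains \<alpha> where "\<alpha> \<noteq> 0" "Lerch_combination s \<alpha> 0 \<in> Lerch_space s"
proof -
  interpret vector_space fun_scale by (rule vector_space_fun_scale)
  have "Lerch_combination s (Lerch_cofactor 0 s) 0 \<in> Lerch_space s"
    "Lerch_combination s (Lerch_cofactor 0 (1 - s)) 0 \<in> Lerch_space s"
    unfolding Lerch_space_def on_open_square_Lerch_plus[symmetric] on_open_square_Lerch_plus_dual[symmetric]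
    by (intro span_base; simp)+
  moreover have "Re s > 0 \<or> Re (1 - s) > 0" by (simp, linarith)
  then have "Lerch_cofactor 0 s \<noteq> 0 \<or> Lerch_cofactor 0 (1 - s) \<noteq> 0"
    using Lerch_cofactor_mult_factor[of s 0] Lerch_cofactor_mult_factor[of "1 - s" 0] by auto
  ultimately show ?thesis using that by blast
qed

lemma Lerch_space_not_in_Lp:
  assumes "p \<ge> 1" "\<not> (1 - 1 / p < Re s \<and> Re s < 1 / p)" "f \<in> Lerch_space s" "f \<noteq> 0"
  shows "\<not> in_Lp unit_square (ereal p) f"
  using assms(3)
proof (cases rule: Lerch_space_elem_cases)
  case (1 \<alpha> \<beta>)
  have "1 / p \<le> Re s \<or> Re s \<le> 1 - 1 / p" using assms(2) by linarith
  then show ?thesis using 1 assms(1,4) by (simp add: Lerch_combination_not_in_Lp)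
qed

lemma Lerch_space_in_Lp_iff:
  assumes "p \<ge> 1"
  shows "(\<forall>f\<in>Lerch_space s. in_Lp unit_square (ereal p) f) \<longleftrightarrow> 1 - 1 / p < Re s \<and> Re s < 1 / p"
proof
  assume all: "\<forall>f\<in>Lerch_space s. in_Lp unit_square (ereal p) f"
  obtain \<alpha> where "\<alpha> \<noteq> 0" "Lerch_combination s \<alpha> 0 \<in> Lerch_space s"
    by (rule Lerch_combination_in_Lerch_space)
  then show "1 - 1 / p < Re s \<and> Re s < 1 / p"
    using all Lerch_combination_not_in_Lp[of p s \<alpha> 0] assms by (meson not_le)
next
  assume "1 - 1 / p < Re s \<and> Re s < 1 / p"
  then show "\<forall>f\<in>Lerch_space s. in_Lp unit_square (ereal p) f"
    using Lerch_combination_in_Lp[of p s] assms by (metis Lerch_space_elem_cases)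
qed

lemma Lerch_space_not_in_Lp_ge_2:
  assumes p: "2 \<le> p" and f: "f \<in> Lerch_space s" "f \<noteq> 0"
  shows "\<not> in_Lp unit_square p f"
proof -
  have finite_exponent: "\<not> in_Lp unit_square (ereal r) f" if "2 \<le> r" for r
  proof -
    have "1 / r \<le> 1 / 2" using that by (intro divide_left_mono) auto
    then have "\<not> (1 - 1 / r < Re s \<and> Re s < 1 / r)" by linarith
    then show ?thesis using that f by (intro Lerch_space_not_in_Lp) auto
  qed
  show ?thesis
  proof (cases p)
    case (real r)
    then show ?thesis using p finite_exponent by simp
  next
    case PInf
    then show ?thesis
      using in_Lp_infinity_imp_in_Lp[OF finite_measure_unit_square, of f 2] finite_exponent[of 2] by auto
  qed (use p in simp)
qed

theorem theorem2p4:
  fixes s :: complex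
  shows "(\<forall>p::real. 1 \<le> p \<and> p < 2 \<longrightarrow>
            ((\<forall>f\<in>Lerch_space s. in_Lp unit_square (ereal p) f)
               \<longleftrightarrow> 1 - 1 / p < Re s \<and> Re s < 1 / p) \<and>
            (\<not> (1 - 1 / p < Re s \<and> Re s < 1 / p) \<longrightarrow>
               (\<forall>f\<in>Lerch_space s. f \<noteq> 0 \<longrightarrow> \<not> in_Lp unit_square (ereal p) f)))
       \<and> (\<forall>p::ereal. 2 \<le> p \<longrightarrow>
            (\<forall>f\<in>Lerch_space s. f \<noteq> 0 \<longrightarrow> \<not> in_Lp unit_square p f))"
proof (intro conjI allI impI ballI)
  fix p :: real assume "1 \<le> p \<and> p < 2"
  then show "(\<forall>f\<in>Lerch_space s. in_Lp unit_square (ereal p) f) \<longleftrightarrow> 1 - 1 / p < Re s \<and> Re s < 1 / p"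
    by (intro Lerch_space_in_Lp_iff) simp
next
  fix p :: real and f
  assume "1 \<le> p \<and> p < 2" "\<not> (1 - 1 / p < Re s \<and> Re s < 1 / p)" "f \<in> Lerch_space s" "f \<noteq> 0"
  then show "\<not> in_Lp unit_square (ereal p) f"
    by (intro Lerch_space_not_in_Lp) simp_all
next
  fix p :: ereal and f
  assume "2 \<le> p" "f \<in> Lerch_space s" "f \<noteq> 0"
  then show "\<not> in_Lp unit_square p f" by (rule Lerch_space_not_in_Lp_ge_2)
qed

end
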